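(* Let $(A,\rhd,\lhd)$ be a dialgebra and $r\in A\otimes A$. Define linear maps $\delta_{\rhd,r},\delta_{\lhd,r}:A\to A\otimes A$ by $$\delta_{\rhd,r}(x)=\big(R_{\star}(x)\otimes\mathrm{id}+\mathrm{id}\otimes L_{\lhd}(x)\big)r,\qquad \delta_{\lhd,r}(x)=\big(R_{\rhd}(x)\otimes\mathrm{id}-\mathrm{id}\otimes L_{\star}(x)\big)r.$$ If $r$ is a solution of the diassociative Yang-Baxter equation (DAYBE) in $(A,\rhd,\lhd)$ and the skew-symmetric part of $r$ is invariant, then $(A,\rhd,\lhd,\delta_{\rhd,r},\delta_{\lhd,r})$ is a bi-dialgebra. In particular, if $r$ is a symmetric solution of the DAYBE, then $(A,\rhd,\lhd,\delta_{\rhd,r},\delta_{\lhd,r})$ is a bi-dialgebra.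
   Context: All vector spaces and algebras are finite-dimensional over a field $\mathbb F$ of characteristic $0$; algebras are not assumed unital. Notation: $L_\diamond(x)y=x\diamond y=R_\diamond(y)x$, $\tau(x\otimes y)=y\otimes x$, $x\star y=x\rhd y-x\lhd y$. **Dialgebra.** $(A,\rhd,\lhd)$ where $\rhd,\lhd$ are associative bilinear products with $(x\lhd y)\lhd z=x\lhd(y\rhd z)$, $(x\rhd y)\lhd z=x\rhd(y\lhd z)$, $(x\lhd y)\rhd z=x\rhd(y\rhd z)$. **DAYBE.** $r=\sum_i a_i\otimes b_i\in A\otimes A$ is a solution of the DAYBE if $r_{13}\rhd r_{23}-r_{23}\lhd r_{12}-r_{12}\star r_{13}=0$ in $A\otimes A\otimes A$, i.e. $$\sum_{i,j}\big(a_i\otimes a_j\otimes b_i\rhd b_j-a_j\otimes a_i\lhd b_j\otimes b_i-a_i\star a_j\otimes b_i\otimes b_j\big)=0.$$ **Invariance.** The skew-symmetric part of $r$ is $\alpha=r-\tau(r)$; $r$ is symmetric if $\tau(r)=r$. An element $s\in A\otimes A$ is invariant if $E(x)s=F(x)s=0$ for all $x\in A$, where $E(x)=R_{\star}(x)\otimes\mathrm{id}+\mathrm{id}\otimes L_{\lhd}(x)$, $F(x)=R_{\rhd}(x)\otimes\mathrm{id}-\mathrm{id}\otimes L_{\star}(x)$. **Co-dialgebra.** $(A,\delta_{\rhd},\delta_{\lhd})$ with $\delta_{\rhd},\delta_{\lhd}:A\to A\otimes A$ linear and coassociative, $(\mathrm{id}\otimes\delta)\delta=(\delta\otimes\mathrm{id})\delta$,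 and $(\mathrm{id}\otimes\delta_{\lhd})\delta_{\lhd}=(\mathrm{id}\otimes\delta_{\rhd})\delta_{\lhd}$, $(\delta_{\rhd}\otimes\mathrm{id})\delta_{\lhd}=(\mathrm{id}\otimes\delta_{\lhd})\delta_{\rhd}$, $(\delta_{\lhd}\otimes\mathrm{id})\delta_{\rhd}=(\delta_{\rhd}\otimes\mathrm{id})\delta_{\rhd}$. **Bi-dialgebra.** $(A,\rhd,\lhd,\delta_{\rhd},\delta_{\lhd})$ with $(A,\rhd,\lhd)$ a dialgebra, $(A,\delta_{\rhd},\delta_{\lhd})$ a co-dialgebra, and, with $\delta_\star=\delta_{\rhd}-\delta_{\lhd}$, for all $x,y\in A$: $(\mathrm{id}\otimes L_{\lhd}(x))\delta_{\lhd}(y)=(R_{\rhd}(y)\otimes\mathrm{id})\delta_{\rhd}(x)$; $(L_{\lhd}(x)\otimes\mathrm{id})\delta_{\rhd}(y)=(\mathrm{id}\otimes L_{\lhd}(y))\tau\delta_{\rhd}(x)$; $(R_{\rhd}(x)\otimes\mathrm{id})\tau\delta_{\lhd}(y)=(\mathrm{id}\otimes R_{\rhd}(y))\delta_{\lhd}(x)$; $\delta_{\rhd}(x\rhd y)=(\mathrm{id}\otimes L_{\rhd}(x))\delta_{\rhd}(y)-(R_{\star}(y)\otimes\mathrm{id})\delta_{\star}(x)$; $\delta_{\rhd}(x\lhd y)=(\mathrm{id}\otimes L_{\lhd}(x))\delta_{\star}(y)+(R_{\lhd}(y)\otimes\mathrm{id})\delta_{\rhd}(x)$; $\delta_{\lhd}(x\rhd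 y)=(\mathrm{id}\otimes L_{\star}(x))\delta_{\lhd}(y)+(R_{\rhd}(y)\otimes\mathrm{id})\delta_{\lhd}(x)$; $\delta_{\lhd}(x\lhd y)=(R_{\lhd}(y)\otimes\mathrm{id})\delta_{\lhd}(x)-(\mathrm{id}\otimes L_{\star}(x))\delta_{\star}(y)$; $(L_{\star}(x)\otimes\mathrm{id})\delta_{\rhd}(y)+(\mathrm{id}\otimes L_{\lhd}(y))\tau\delta_{\lhd}(x)=(R_{\star}(y)\otimes\mathrm{id})\tau\delta_{\star}(x)+(\mathrm{id}\otimes R_{\lhd}(x))\delta_{\rhd}(y)$; $(R_{\lhd}(x)\otimes\mathrm{id})\tau\delta_{\lhd}(y)+(\mathrm{id}\otimes R_{\rhd}(y))\delta_{\star}(x)=(L_{\star}(y)\otimes\mathrm{id})\delta_{\star}(x)+(\mathrm{id}\otimes L_{\rhd}(x))\tau\delta_{\lhd}(y)$. *)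

theory Defs
  imports Complex_Main "HOL-Library.Function_Algebras"
begin

text \<open>
  The tensor powers of a vector space \<open>V\<close> are realised inside the multilinear forms on the dual
  space: \<open>a \<otimes> b\<close> is the form \<open>(\<phi>, \<psi>) \<mapsto> \<phi>(a) \<psi>(b)\<close> on \<open>V* \<times> V*\<close>, and \<open>V \<otimes> V\<close> is the set of
  finite sums of such forms; likewise for \<open>V \<otimes> V \<otimes> V\<close>. Since HOL functions are total, forms are
  extended by 0 to arguments that are not linear functionals, so that equality of tensors is
  equality of functions. Addition, negation and 0 are pointwise.
  The lemmas \<open>tens_universal\<close> and \<open>tens3_universal\<close> below state that these spaces have the universal
  property of the tensor product.
\<close>

type_synonym ('f, 'v) tensor2 = "('v \<Rightarrow> 'f) \<Rightarrow> ('v \<Rightarrow> 'f) \<Rightarrow> 'f"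
type_synonym ('f, 'v) tensor3 = "('v \<Rightarrow> 'f) \<Rightarrow> ('v \<Rightarrow> 'f) \<Rightarrow> ('v \<Rightarrow> 'f) \<Rightarrow> 'f"

definition tensor_scale :: "'f::field \<Rightarrow> ('f, 'v) tensor2 \<Rightarrow> ('f, 'v) tensor2" where
  "tensor_scale c t = (\<lambda>\<phi> \<psi>. c * t \<phi> \<psi>)"

definition flip :: "('f, 'v) tensor2 \<Rightarrow> ('f, 'v) tensor2" ("\<tau>") where
  "\<tau> t = (\<lambda>\<phi> \<psi>. t \<psi> \<phi>)"

definition lmult :: "('v \<Rightarrow> 'v \<Rightarrow> 'v) \<Rightarrow> 'v \<Rightarrow> 'v \<Rightarrow> 'v" where
  "lmult m x = (\<lambda>y. m x y)"

definition rmult :: "('v \<Rightarrow> 'v \<Rightarrow> 'v) \<Rightarrow> 'v \<Rightarrow> 'v \<Rightarrow> 'v" where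
  "rmult m x = (\<lambda>y. m y x)"

locale fd_space = finite_dimensional_vector_space scale Basis
  for scale :: "'f::field_char_0 \<Rightarrow> 'v::ab_group_add \<Rightarrow> 'v" (infixr "*s" 75)
    and Basis :: "'v set"
begin

definition dual :: "('v \<Rightarrow> 'f) set" where
  "dual = {\<phi>. Vector_Spaces.linear scale (*) \<phi>}"

definition tens :: "'v \<Rightarrow> 'v \<Rightarrow> ('f, 'v) tensor2" (infixr "\<otimes>" 75) where
  "a \<otimes> b = (\<lambda>\<phi> \<psi>. if \<phi> \<in> dual \<and> \<psi> \<in> dual then \<phi> a * \<psi> b else 0)"

definition tens3 :: "'v \<Rightarrow> 'v \<Rightarrow> 'v \<Rightarrow> ('f, 'v) tensor3" where
  "tens3 a b c = (\<lambda>\<phi> \<psi> \<chi>. if \<phi> \<in> dual \<and> \<psi> \<in> dual \<and> \<chi> \<in> dual then \<phi> a * \<psi> b * \<chi> c else 0)"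

definition tensor_space :: "('f, 'v) tensor2 set" where
  "tensor_space = {t. \<exists>(n::nat) a b. t = (\<Sum>i<n. a i \<otimes> b i)}"

text \<open>
  \<open>f \<otimes> g\<close> for linear maps \<open>f\<close>, \<open>g\<close> on \<open>V\<close>, and \<open>id \<otimes> \<delta>\<close>, \<open>\<delta> \<otimes> id\<close> for linear
  \<open>\<delta> : V \<rightarrow> V \<otimes> V\<close>, as precomposition with the transposed maps; see \<open>tmap_tens\<close>,
  \<open>id_tens_tens\<close> and \<open>tens_id_tens\<close> for the values on pure tensors.
\<close>

definition tmap :: "('v \<Rightarrow> 'v) \<Rightarrow> ('v \<Rightarrow> 'v) \<Rightarrow> ('f, 'v) tensor2 \<Rightarrow> ('f, 'v) tensor2"
    (infixr "\<otimes>\<^sub>m" 75) where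
  "(f \<otimes>\<^sub>m g) t = (\<lambda>\<phi> \<psi>. if \<phi> \<in> dual \<and> \<psi> \<in> dual then t (\<phi> \<circ> f) (\<psi> \<circ> g) else 0)"

definition id_tens :: "('v \<Rightarrow> ('f, 'v) tensor2) \<Rightarrow> ('f, 'v) tensor2 \<Rightarrow> ('f, 'v) tensor3" where
  "id_tens \<delta> t = (\<lambda>\<phi> \<psi> \<chi>. if \<phi> \<in> dual \<and> \<psi> \<in> dual \<and> \<chi> \<in> dual then t \<phi> (\<lambda>y. \<delta> y \<psi> \<chi>) else 0)"

definition tens_id :: "('v \<Rightarrow> ('f, 'v) tensor2) \<Rightarrow> ('f, 'v) tensor2 \<Rightarrow> ('f, 'v) tensor3" where
  "tens_id \<delta> t = (\<lambda>\<phi> \<psi> \<chi>. if \<phi> \<in> dual \<and> \<psi> \<in> dual \<and> \<chi> \<in> dual then t (\<lambda>x. \<delta> x \<phi> \<psi>) \<chi> else 0)"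

end

lemma sum_apply: "(\<Sum>i\<in>I. f i) x = (\<Sum>i\<in>I. f i x :: 'b::comm_monoid_add)"
  by (induction I rule: infinite_finite_induct) auto

context fd_space
begin

lemma vector_space_mult: "vector_space ((*) :: 'f \<Rightarrow> 'f \<Rightarrow> 'f)"
  by unfold_locales (auto simp: algebra_simps)

lemma dual_iff: "\<phi> \<in> dual \<longleftrightarrow> (\<forall>x y. \<phi> (x + y) = \<phi> x + \<phi> y) \<and> (\<forall>c x. \<phi> (scale c x) = c * \<phi> x)"
  unfolding dual_def mem_Collect_eq
  using vector_space_axioms vector_space_mult
  by (auto simp: Vector_Spaces.linear_def module_hom_def module_hom_axioms_def
        module_iff_vector_space)

lemma dual_comp: "Vector_Spaces.linear scale scale f \<Longrightarrow> \<phi> \<in> dual \<Longrightarrow> \<phi> \<circ> f \<in> dual"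
  unfolding dual_def by (auto intro: Vector_Spaces.linear_compose)

lemma flip_tens: "\<tau> (a \<otimes> b) = b \<otimes> a"
  by (auto simp: flip_def tens_def fun_eq_iff)

lemma tmap_tens:
  assumes "Vector_Spaces.linear scale scale f" "Vector_Spaces.linear scale scale g"
  shows "(f \<otimes>\<^sub>m g) (a \<otimes> b) = f a \<otimes> g b"
  using assms by (auto simp: tmap_def tens_def fun_eq_iff dual_comp)

lemma linear_apply_tens:
  assumes "Vector_Spaces.linear scale tensor_scale \<delta>"
  shows "(\<lambda>y. \<delta> y \<psi> \<chi>) \<in> dual"
  using Vector_Spaces.linear.axioms(3)[OF assms]
  by (auto simp: dual_iff tensor_scale_def module_hom_def module_hom_axioms_def)

lemma id_tens_tens:
  assumes "Vector_Spaces.linear scale tensor_scale \<delta>" "\<delta> b = (\<Sum>k<n. c k \<otimes> d k)"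
  shows "id_tens \<delta> (a \<otimes> b) = (\<Sum>k<n::nat. tens3 a (c k) (d k))"
  using linear_apply_tens[OF assms(1)]
  by (auto simp: id_tens_def assms(2) sum_apply tens_def tens3_def fun_eq_iff
      sum_distrib_left mult.assoc)

lemma tens_id_tens:
  assumes "Vector_Spaces.linear scale tensor_scale \<delta>" "\<delta> a = (\<Sum>k<n. c k \<otimes> d k)"
  shows "tens_id \<delta> (a \<otimes> b) = (\<Sum>k<n::nat. tens3 (c k) (d k) b)"
  using linear_apply_tens[OF assms(1)]
  by (auto simp: tens_id_def assms(2) sum_apply tens_def tens3_def fun_eq_iff
      sum_distrib_right mult.assoc)

lemma tens_bilinear:
  "(a + a') \<otimes> b = a \<otimes> b + a' \<otimes> b" "a \<otimes> (b + b') = a \<otimes> b + a \<otimes> b'"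
  "scale c a \<otimes> b = tensor_scale c (a \<otimes> b)" "a \<otimes> scale c b = tensor_scale c (a \<otimes> b)"
  by (auto simp: tens_def fun_eq_iff dual_iff tensor_scale_def algebra_simps)

lemma coord_dual: "(\<lambda>v. representation Basis v p) \<in> dual"
  by (auto simp: dual_iff representation_add representation_scale independent_Basis span_Basis)

lemma linear_expand:
  assumes "Vector_Spaces.linear scale s h"
  shows "h v = (\<Sum>p\<in>Basis. s (representation Basis v p) (h p))"
proof -
  interpret h: Vector_Spaces.linear scale s h by fact
  have "v = (\<Sum>p\<in>Basis. scale (representation Basis v p) p)"
    using sum_representation_eq[of Basis v Basis] independent_Basis span_Basis finite_Basis by auto
  then have "h v = h (\<Sum>p\<in>Basis. scale (representation Basis v p) p)" by simp
  then show ?thesis by (simp add: h.sum h.scale)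
qed

text \<open>
  Every bilinear (trilinear) map factors through the tensor square (cube): its value on a sum of
  pure tensors depends only on the tensor.
\<close>

lemma tens_universal:
  fixes B :: "'v \<Rightarrow> 'v \<Rightarrow> 'u::ab_group_add" and n m :: nat
  assumes lin: "\<And>x. Vector_Spaces.linear scale s (B x)"
      "\<And>y. Vector_Spaces.linear scale s (\<lambda>x. B x y)"
    and eq: "(\<Sum>i<n. a i \<otimes> b i) = (\<Sum>j<m. c j \<otimes> d j)"
  shows "(\<Sum>i<n. B (a i) (b i)) = (\<Sum>j<m. B (c j) (d j))"
proof -
  let ?r = "\<lambda>p v. representation Basis v p"
  interpret s: vector_space s using lin(1)[of undefined] by (simp add: Vector_Spaces.linear_def)
  have B: "B x y = (\<Sum>p\<in>Basis. \<Sum>q\<in>Basis. s ((x \<otimes> y) (?r p) (?r q)) (B p q))" for x y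
    unfolding linear_expand[OF lin(2), of x y]
    by (subst linear_expand[OF lin(1), of _ y])
       (simp add: s.scale_sum_right tens_def coord_dual)
  have *: "(\<Sum>i<k. B (f i) (g i)) =
      (\<Sum>p\<in>Basis. \<Sum>q\<in>Basis. s ((\<Sum>i<k. f i \<otimes> g i) (?r p) (?r q)) (B p q))" for k :: nat and f g
    unfolding sum_apply s.scale_sum_left
    by (subst B, subst sum.swap, intro sum.cong refl, rule sum.swap)
  show ?thesis unfolding * eq ..
qed

lemma tens3_universal:
  fixes B :: "'v \<Rightarrow> 'v \<Rightarrow> 'v \<Rightarrow> 'u::ab_group_add" and n m :: nat
  assumes lin: "\<And>x y. Vector_Spaces.linear scale s (B x y)"
      "\<And>x z. Vector_Spaces.linear scale s (\<lambda>y. B x y z)"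
      "\<And>y z. Vector_Spaces.linear scale s (\<lambda>x. B x y z)"
    and eq: "(\<Sum>i<n. tens3 (a i) (b i) (c i)) = (\<Sum>j<m. tens3 (a' j) (b' j) (c' j))"
  shows "(\<Sum>i<n. B (a i) (b i) (c i)) = (\<Sum>j<m. B (a' j) (b' j) (c' j))"
proof -
  let ?r = "\<lambda>p v. representation Basis v p"
  interpret s: vector_space s
    using lin(1)[of undefined undefined] by (simp add: Vector_Spaces.linear_def)
  have B: "B x y z = (\<Sum>p\<in>Basis. \<Sum>q\<in>Basis. \<Sum>k\<in>Basis.
      s (tens3 x y z (?r p) (?r q) (?r k)) (B p q k))" for x y z
    unfolding linear_expand[OF lin(3), of x y z]
    by (subst linear_expand[OF lin(2), of _ y z], subst linear_expand[OF lin(1), of _ _ z])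
       (simp add: s.scale_sum_right tens3_def coord_dual mult.assoc)
  have *: "(\<Sum>i<l. B (f i) (g i) (h i)) =
      (\<Sum>p\<in>Basis. \<Sum>q\<in>Basis. \<Sum>k\<in>Basis.
        s ((\<Sum>i<l. tens3 (f i) (g i) (h i)) (?r p) (?r q) (?r k)) (B p q k))"
    for l :: nat and f g h
    unfolding sum_apply s.scale_sum_left
    by (subst B, subst sum.swap, intro sum.cong refl, subst sum.swap, intro sum.cong refl,
        rule sum.swap)
  show ?thesis unfolding * eq ..
qed

end


locale dialgebra = fd_space scale Basis
  for scale :: "'f::field_char_0 \<Rightarrow> 'v::ab_group_add \<Rightarrow> 'v" (infixr "*s" 75)
    and Basis :: "'v set" +
  fixes rhd :: "'v \<Rightarrow> 'v \<Rightarrow> 'v" (infixl "\<rhd>" 80)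
    and lhd :: "'v \<Rightarrow> 'v \<Rightarrow> 'v" (infixl "\<lhd>" 80)
  assumes linear_rhd: "Vector_Spaces.linear scale scale (\<lambda>y. x \<rhd> y)"
      "Vector_Spaces.linear scale scale (\<lambda>x. x \<rhd> y)"
    and linear_lhd: "Vector_Spaces.linear scale scale (\<lambda>y. x \<lhd> y)"
      "Vector_Spaces.linear scale scale (\<lambda>x. x \<lhd> y)"
    and assoc_rhd: "(x \<rhd> y) \<rhd> z = x \<rhd> (y \<rhd> z)"
    and assoc_lhd: "(x \<lhd> y) \<lhd> z = x \<lhd> (y \<lhd> z)"
    and dialg1: "(x \<lhd> y) \<lhd> z = x \<lhd> (y \<rhd> z)"
    and dialg2: "(x \<rhd> y) \<lhd> z = x \<rhd> (y \<lhd> z)"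
    and dialg3: "(x \<lhd> y) \<rhd> z = x \<rhd> (y \<rhd> z)"
begin

definition star :: "'v \<Rightarrow> 'v \<Rightarrow> 'v" (infixl "\<star>" 80) where
  "x \<star> y = x \<rhd> y - x \<lhd> y"

text \<open>The element of the tensor cube whose vanishing is the DAYBE for \<open>r = (\<Sum>i<n. a i \<otimes> b i)\<close>.\<close>

definition daybe_sum :: "nat \<Rightarrow> (nat \<Rightarrow> 'v) \<Rightarrow> (nat \<Rightarrow> 'v) \<Rightarrow> ('f, 'v) tensor3" where
  "daybe_sum n a b = (\<Sum>i<n. \<Sum>j<n.
     tens3 (a i) (a j) (b i \<rhd> b j) - tens3 (a j) (a i \<lhd> b j) (b i) - tens3 (a i \<star> a j) (b i) (b j))"

definition daybe_solution :: "('f, 'v) tensor2 \<Rightarrow> bool" where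
  "daybe_solution r \<longleftrightarrow> (\<exists>n a b. r = (\<Sum>i<n. a i \<otimes> b i) \<and> daybe_sum n a b = 0)"

definition E_map :: "'v \<Rightarrow> ('f, 'v) tensor2 \<Rightarrow> ('f, 'v) tensor2" where
  "E_map x s = (rmult (\<star>) x \<otimes>\<^sub>m id) s + (id \<otimes>\<^sub>m lmult (\<lhd>) x) s"

definition F_map :: "'v \<Rightarrow> ('f, 'v) tensor2 \<Rightarrow> ('f, 'v) tensor2" where
  "F_map x s = (rmult (\<rhd>) x \<otimes>\<^sub>m id) s - (id \<otimes>\<^sub>m lmult (\<star>) x) s"

definition invariant :: "('f, 'v) tensor2 \<Rightarrow> bool" where
  "invariant s \<longleftrightarrow> (\<forall>x. E_map x s = 0 \<and> F_map x s = 0)"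

definition skew_part :: "('f, 'v) tensor2 \<Rightarrow> ('f, 'v) tensor2" where
  "skew_part r = r - \<tau> r"

definition symmetric :: "('f, 'v) tensor2 \<Rightarrow> bool" where
  "symmetric r \<longleftrightarrow> \<tau> r = r"

definition delta_rhd_of :: "('f, 'v) tensor2 \<Rightarrow> 'v \<Rightarrow> ('f, 'v) tensor2" where
  "delta_rhd_of r x = (rmult (\<star>) x \<otimes>\<^sub>m id) r + (id \<otimes>\<^sub>m lmult (\<lhd>) x) r"

definition delta_lhd_of :: "('f, 'v) tensor2 \<Rightarrow> 'v \<Rightarrow> ('f, 'v) tensor2" where
  "delta_lhd_of r x = (rmult (\<rhd>) x \<otimes>\<^sub>m id) r - (id \<otimes>\<^sub>m lmult (\<star>) x) r"

lemma daybe_sum_eq: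
  assumes r: "r = (\<Sum>i<n. a i \<otimes> b i)" and d: "\<phi> \<in> dual" "\<psi> \<in> dual" "\<chi> \<in> dual"
  shows "daybe_sum n a b \<phi> \<psi> \<chi> =
     r \<phi> (\<lambda>y. r \<psi> (\<lambda>z. \<chi> (y \<rhd> z))) - r (\<lambda>x. r \<phi> (\<lambda>z. \<psi> (x \<lhd> z))) \<chi>
       - r (\<lambda>x. r (\<lambda>y. \<phi> (x \<star> y)) \<chi>) \<psi>"
proof -
  have comp: "(\<lambda>z. \<xi> (f z)) \<in> dual" if "\<xi> \<in> dual" "Vector_Spaces.linear scale scale f" for \<xi> f
    using dual_comp[OF that(2,1)] by (simp add: comp_def)
  have lstar: "Vector_Spaces.linear scale scale (\<lambda>y. x \<star> y)"
    "Vector_Spaces.linear scale scale (\<lambda>y. y \<star> x)" for x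
    unfolding star_def
    using linear_rhd linear_lhd
    by (auto intro!: vector_space_pair.linear_compose_sub simp: vector_space_pair_def vector_space_axioms)
  have sumd: "(\<lambda>y. \<Sum>i\<in>I. g i * h i y) \<in> dual" if "\<And>i. h i \<in> dual" for I :: "nat set" and g h
    using that by (auto simp: dual_iff sum.distrib sum_distrib_left algebra_simps)
  have sumd': "(\<lambda>y. \<Sum>i\<in>I. h i y * g i) \<in> dual" if "\<And>i. h i \<in> dual" for I :: "nat set" and g h
    using sumd[of h g I] that by (simp add: mult.commute)
  note L = comp[OF _ linear_rhd(1)] comp[OF _ linear_rhd(2)] comp[OF _ linear_lhd(1)]
    comp[OF _ linear_lhd(2)] comp[OF _ lstar(1)] comp[OF _ lstar(2)]
  have ev: "r \<xi> \<zeta> = (\<Sum>i<n. \<xi> (a i) * \<zeta> (b i))" if "\<xi> \<in> dual" "\<zeta> \<in> dual" for \<xi> \<zeta>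
    using that by (simp add: r sum_apply tens_def)
  have 1: "r \<phi> (\<lambda>y. r \<psi> (\<lambda>z. \<chi> (y \<rhd> z))) =
      (\<Sum>i<n. \<Sum>j<n. \<phi> (a i) * \<psi> (a j) * \<chi> (b i \<rhd> b j))"
    using d by (simp add: ev L sumd sum_distrib_left mult.assoc)
  have 2: "r (\<lambda>x. r \<phi> (\<lambda>z. \<psi> (x \<lhd> z))) \<chi> =
      (\<Sum>i<n. \<Sum>j<n. \<phi> (a j) * \<psi> (a i \<lhd> b j) * \<chi> (b i))"
    using d by (simp add: ev L sumd sum_distrib_right)
  have "r (\<lambda>x. r (\<lambda>y. \<phi> (x \<star> y)) \<chi>) \<psi> =
      (\<Sum>i<n. (\<Sum>j<n. \<phi> (a i \<star> a j) * \<chi> (b j)) * \<psi> (b i))"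
    using d by (simp add: ev L sumd')
  then have 3: "r (\<lambda>x. r (\<lambda>y. \<phi> (x \<star> y)) \<chi>) \<psi> =
      (\<Sum>i<n. \<Sum>j<n. \<phi> (a i \<star> a j) * \<psi> (b i) * \<chi> (b j))"
    by (simp add: sum_distrib_left mult_ac)
  show ?thesis
    unfolding daybe_sum_def 1 2 3 using d
    by (simp add: sum_apply tens3_def sum_subtractf)
qed

text \<open>The DAYBE does not depend on the chosen decomposition of \<open>r\<close> into pure tensors.\<close>

lemma daybe_sum_decomposition_independent:
  fixes n m :: nat
  assumes "(\<Sum>i<n. a i \<otimes> b i) = (\<Sum>i<m. c i \<otimes> d i)"
  shows "daybe_sum n a b = daybe_sum m c d"
proof (intro ext)
  fix \<phi> \<psi> \<chi> :: "'v \<Rightarrow> 'f"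
  show "daybe_sum n a b \<phi> \<psi> \<chi> = daybe_sum m c d \<phi> \<psi> \<chi>"
  proof (cases "\<phi> \<in> dual \<and> \<psi> \<in> dual \<and> \<chi> \<in> dual")
    case True
    then show ?thesis
      using daybe_sum_eq[OF refl, of \<phi> \<psi> \<chi> n a b] daybe_sum_eq[OF refl, of \<phi> \<psi> \<chi> m c d] assms
      by simp
  next
    case False
    then show ?thesis by (auto simp: daybe_sum_def sum_apply tens3_def)
  qed
qed

end

locale co_dialgebra = fd_space scale Basis
  for scale :: "'f::field_char_0 \<Rightarrow> 'v::ab_group_add \<Rightarrow> 'v" (infixr "*s" 75)
    and Basis :: "'v set" +
  fixes delta_rhd :: "'v \<Rightarrow> ('f, 'v) tensor2" ("\<delta>\<^sub>\<rhd>")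
    and delta_lhd :: "'v \<Rightarrow> ('f, 'v) tensor2" ("\<delta>\<^sub>\<lhd>")
  assumes delta_rhd_linear: "Vector_Spaces.linear scale tensor_scale \<delta>\<^sub>\<rhd>"
    and delta_lhd_linear: "Vector_Spaces.linear scale tensor_scale \<delta>\<^sub>\<lhd>"
    and delta_rhd_mem: "\<delta>\<^sub>\<rhd> x \<in> tensor_space"
    and delta_lhd_mem: "\<delta>\<^sub>\<lhd> x \<in> tensor_space"
    and coassoc_rhd: "id_tens \<delta>\<^sub>\<rhd> (\<delta>\<^sub>\<rhd> x) = tens_id \<delta>\<^sub>\<rhd> (\<delta>\<^sub>\<rhd> x)"
    and coassoc_lhd: "id_tens \<delta>\<^sub>\<lhd> (\<delta>\<^sub>\<lhd> x) = tens_id \<delta>\<^sub>\<lhd> (\<delta>\<^sub>\<lhd> x)"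
    and codialg1: "id_tens \<delta>\<^sub>\<lhd> (\<delta>\<^sub>\<lhd> x) = id_tens \<delta>\<^sub>\<rhd> (\<delta>\<^sub>\<lhd> x)"
    and codialg2: "tens_id \<delta>\<^sub>\<rhd> (\<delta>\<^sub>\<lhd> x) = id_tens \<delta>\<^sub>\<lhd> (\<delta>\<^sub>\<rhd> x)"
    and codialg3: "tens_id \<delta>\<^sub>\<lhd> (\<delta>\<^sub>\<rhd> x) = tens_id \<delta>\<^sub>\<rhd> (\<delta>\<^sub>\<rhd> x)"
begin

definition delta_star :: "'v \<Rightarrow> ('f, 'v) tensor2" ("\<delta>\<^sub>\<star>") where
  "\<delta>\<^sub>\<star> x = \<delta>\<^sub>\<rhd> x - \<delta>\<^sub>\<lhd> x"

end

locale bi_dialgebra =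
  dialgebra scale Basis rhd lhd + co_dialgebra scale Basis delta_rhd delta_lhd
  for scale :: "'f::field_char_0 \<Rightarrow> 'v::ab_group_add \<Rightarrow> 'v" (infixr "*s" 75)
    and Basis :: "'v set"
    and rhd :: "'v \<Rightarrow> 'v \<Rightarrow> 'v" (infixl "\<rhd>" 80)
    and lhd :: "'v \<Rightarrow> 'v \<Rightarrow> 'v" (infixl "\<lhd>" 80)
    and delta_rhd :: "'v \<Rightarrow> ('f, 'v) tensor2" ("\<delta>\<^sub>\<rhd>")
    and delta_lhd :: "'v \<Rightarrow> ('f, 'v) tensor2" ("\<delta>\<^sub>\<lhd>") +
  assumes bi1: "(id \<otimes>\<^sub>m lmult (\<lhd>) x) (\<delta>\<^sub>\<lhd> y) = (rmult (\<rhd>) y \<otimes>\<^sub>m id) (\<delta>\<^sub>\<rhd> x)"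
    and bi2: "(lmult (\<lhd>) x \<otimes>\<^sub>m id) (\<delta>\<^sub>\<rhd> y) = (id \<otimes>\<^sub>m lmult (\<lhd>) y) (\<tau> (\<delta>\<^sub>\<rhd> x))"
    and bi3: "(rmult (\<rhd>) x \<otimes>\<^sub>m id) (\<tau> (\<delta>\<^sub>\<lhd> y)) = (id \<otimes>\<^sub>m rmult (\<rhd>) y) (\<delta>\<^sub>\<lhd> x)"
    and bi4: "\<delta>\<^sub>\<rhd> (x \<rhd> y) = (id \<otimes>\<^sub>m lmult (\<rhd>) x) (\<delta>\<^sub>\<rhd> y) - (rmult (\<star>) y \<otimes>\<^sub>m id) (\<delta>\<^sub>\<star> x)"
    and bi5: "\<delta>\<^sub>\<rhd> (x \<lhd> y) = (id \<otimes>\<^sub>m lmult (\<lhd>) x) (\<delta>\<^sub>\<star> y) + (rmult (\<lhd>) y \<otimes>\<^sub>m id) (\<delta>\<^sub>\<rhd> x)"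
    and bi6: "\<delta>\<^sub>\<lhd> (x \<rhd> y) = (id \<otimes>\<^sub>m lmult (\<star>) x) (\<delta>\<^sub>\<lhd> y) + (rmult (\<rhd>) y \<otimes>\<^sub>m id) (\<delta>\<^sub>\<lhd> x)"
    and bi7: "\<delta>\<^sub>\<lhd> (x \<lhd> y) = (rmult (\<lhd>) y \<otimes>\<^sub>m id) (\<delta>\<^sub>\<lhd> x) - (id \<otimes>\<^sub>m lmult (\<star>) x) (\<delta>\<^sub>\<star> y)"
    and bi8: "(lmult (\<star>) x \<otimes>\<^sub>m id) (\<delta>\<^sub>\<rhd> y) + (id \<otimes>\<^sub>m lmult (\<lhd>) y) (\<tau> (\<delta>\<^sub>\<lhd> x)) =
      (rmult (\<star>) y \<otimes>\<^sub>m id) (\<tau> (\<delta>\<^sub>\<star> x)) + (id \<otimes>\<^sub>m rmult (\<lhd>) x) (\<delta>\<^sub>\<rhd> y)"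
    and bi9: "(rmult (\<lhd>) x \<otimes>\<^sub>m id) (\<tau> (\<delta>\<^sub>\<lhd> y)) + (id \<otimes>\<^sub>m rmult (\<rhd>) y) (\<delta>\<^sub>\<star> x) =
      (lmult (\<star>) y \<otimes>\<^sub>m id) (\<delta>\<^sub>\<star> x) + (id \<otimes>\<^sub>m lmult (\<rhd>) x) (\<tau> (\<delta>\<^sub>\<lhd> y))"

end

theory Submission
  imports Defs
begin

text \<open>
  Evaluate all tensors on linear functionals. Modulo the dialgebra axioms, each coassociativity defect
  of \<open>\<delta>\<^sub>\<rhd>\<close>, \<open>\<delta>\<^sub>\<lhd>\<close> is a combination of multiplications by \<open>x\<close>, applied in the first or
  third tensor factor, of the three tensors
  \<open>r\<^sub>1\<^sub>3 \<rhd> r\<^sub>2\<^sub>3 - r\<^sub>2\<^sub>3 \<lhd> r\<^sub>1\<^sub>2 - r\<^sub>1\<^sub>2 \<star> r\<^sub>1\<^sub>3\<close>,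
  \<open>r\<^sub>1\<^sub>2 \<rhd> r\<^sub>1\<^sub>3 - r\<^sub>1\<^sub>3 \<lhd> r\<^sub>2\<^sub>3 - r\<^sub>2\<^sub>3 \<star> r\<^sub>1\<^sub>2\<close> and
  \<open>r\<^sub>2\<^sub>3 \<rhd> r\<^sub>1\<^sub>2 - r\<^sub>1\<^sub>2 \<lhd> r\<^sub>1\<^sub>3 - r\<^sub>1\<^sub>3 \<star> r\<^sub>2\<^sub>3\<close>.
  The first is the left-hand side of the DAYBE. The other two are its cyclic permutations, up to
  replacing some factors \<open>r\<close> by \<open>\<tau> r\<close>; invariance of \<open>\<alpha> = r - \<tau> r\<close> ensures that these
  replacements do not matter. Of the compatibility conditions, five hold for every \<open>r\<close>, and the
  defects of the other four are values of \<open>\<alpha>\<close> that vanish by invariance.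
\<close>

text \<open>
  For \<open>r = (\<Sum>i<n. a i \<otimes> b i)\<close>, \<open>s = (\<Sum>j<n. c j \<otimes> d j)\<close> and a product \<open>m\<close>, these are the elements
  \<open>r\<^sub>1\<^sub>2 m s\<^sub>1\<^sub>3\<close>, \<open>r\<^sub>2\<^sub>3 m s\<^sub>1\<^sub>2\<close> and \<open>r\<^sub>1\<^sub>3 m s\<^sub>2\<^sub>3\<close> of the tensor cube.
\<close>

definition prod12_13 ::
  "nat \<Rightarrow> ('v \<Rightarrow> 'v \<Rightarrow> 'v) \<Rightarrow> (nat \<Rightarrow> 'v) \<Rightarrow> (nat \<Rightarrow> 'v) \<Rightarrow> (nat \<Rightarrow> 'v) \<Rightarrow> (nat \<Rightarrow> 'v)
    \<Rightarrow> ('f::comm_ring, 'v) tensor3" where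
  "prod12_13 n m a b c d \<phi> \<psi> \<chi> = (\<Sum>i<n. \<Sum>j<n. \<phi> (m (a i) (c j)) * \<psi> (b i) * \<chi> (d j))"

definition prod23_12 ::
  "nat \<Rightarrow> ('v \<Rightarrow> 'v \<Rightarrow> 'v) \<Rightarrow> (nat \<Rightarrow> 'v) \<Rightarrow> (nat \<Rightarrow> 'v) \<Rightarrow> (nat \<Rightarrow> 'v) \<Rightarrow> (nat \<Rightarrow> 'v)
    \<Rightarrow> ('f::comm_ring, 'v) tensor3" where
  "prod23_12 n m a b c d \<phi> \<psi> \<chi> = (\<Sum>i<n. \<Sum>j<n. \<phi> (c j) * \<psi> (m (a i) (d j)) * \<chi> (b i))"

definition prod13_23 ::
  "nat \<Rightarrow> ('v \<Rightarrow> 'v \<Rightarrow> 'v) \<Rightarrow> (nat \<Rightarrow> 'v) \<Rightarrow> (nat \<Rightarrow> 'v) \<Rightarrow> (nat \<Rightarrow> 'v) \<Rightarrow> (nat \<Rightarrow> 'v)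
    \<Rightarrow> ('f::comm_ring, 'v) tensor3" where
  "prod13_23 n m a b c d \<phi> \<psi> \<chi> = (\<Sum>i<n. \<Sum>j<n. \<phi> (a i) * \<psi> (c j) * \<chi> (m (b i) (d j)))"

subsection \<open>Functionals and tensors\<close>

context fd_space
begin

lemma dual_add: "\<phi> \<in> dual \<Longrightarrow> \<phi> (x + y) = \<phi> x + \<phi> y"
  and dual_scale: "\<phi> \<in> dual \<Longrightarrow> \<phi> (c *s x) = c * \<phi> x"
  by (auto simp: dual_iff)

lemma dual_zero: "\<phi> \<in> dual \<Longrightarrow> \<phi> 0 = 0"
  using dual_add[of \<phi> 0 0] by simp

lemma dual_diff: "\<phi> \<in> dual \<Longrightarrow> \<phi> (x - y) = \<phi> x - \<phi> y"
  using dual_add[of \<phi> "x - y" y] by simp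

lemma dual_minus: "\<phi> \<in> dual \<Longrightarrow> \<phi> (- x) = - \<phi> x"
  using dual_diff[of \<phi> 0 x] dual_zero by simp

lemma dual_linear_comp:
  assumes "\<phi> \<in> dual" "Vector_Spaces.linear scale scale f"
  shows "(\<lambda>x. \<phi> (f x)) \<in> dual"
  using dual_comp[OF assms(2,1)] by (simp add: comp_def)

lemma linear_scale_iff:
  "Vector_Spaces.linear scale scale f \<longleftrightarrow>
    (\<forall>x y. f (x + y) = f x + f y) \<and> (\<forall>c x. f (c *s x) = c *s f x)"
  using vector_space_axioms
  by (auto simp: Vector_Spaces.linear_def module_hom_def module_hom_axioms_def
        module_iff_vector_space)

lemma linear_tensor_scale_iff:
  fixes \<delta> :: "'v \<Rightarrow> ('f, 'v) tensor2"
  shows "Vector_Spaces.linear scale tensor_scale \<delta> \<longleftrightarrow>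
    (\<forall>x y. \<delta> (x + y) = \<delta> x + \<delta> y) \<and> (\<forall>c x. \<delta> (c *s x) = tensor_scale c (\<delta> x))"
proof -
  have "vector_space (tensor_scale :: 'f \<Rightarrow> ('f, 'v) tensor2 \<Rightarrow> _)"
    by unfold_locales (auto simp: tensor_scale_def fun_eq_iff algebra_simps)
  then show ?thesis
    using vector_space_axioms
    by (auto simp: Vector_Spaces.linear_def module_hom_def module_hom_axioms_def
          module_iff_vector_space)
qed

lemma tensor_space_add:
  assumes "s \<in> tensor_space" "t \<in> tensor_space"
  shows "s + t \<in> tensor_space"
proof -
  obtain n m :: nat and a b c d where st: "s = (\<Sum>i<n. a i \<otimes> b i)" "t = (\<Sum>i<m. c i \<otimes> d i)"
    using assms by (auto simp: tensor_space_def)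
  \<comment> \<open>Concatenation of the two families: the summands of \<open>s\<close> occupy the
    indices below \<open>n\<close>, those of \<open>t\<close> are shifted up by
    \<open>n\<close>.\<close>
  let ?f = "\<lambda>i. if i < n then a i else c (i - n)" and ?g = "\<lambda>i. if i < n then b i else d (i - n)"
  have "(\<Sum>i<n + k. ?f i \<otimes> ?g i) = (\<Sum>i<n. a i \<otimes> b i) + (\<Sum>i<k. c i \<otimes> d i)" for k
    by (induction k) (simp_all add: add.assoc)
  then have "s + t = (\<Sum>i<n + m. ?f i \<otimes> ?g i)"
    using st by simp
  then show ?thesis
    unfolding tensor_space_def by (intro CollectI exI[of _ "n + m"] exI[of _ ?f] exI[of _ ?g])
qed

lemma tmap_add: "(f \<otimes>\<^sub>m g) (s + t) = (f \<otimes>\<^sub>m g) s + (f \<otimes>\<^sub>m g) t"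
  by (auto simp: tmap_def fun_eq_iff)

lemma tmap_mem_tensor_space:
  assumes "Vector_Spaces.linear scale scale f" "Vector_Spaces.linear scale scale g"
    and "t \<in> tensor_space"
  shows "(f \<otimes>\<^sub>m g) t \<in> tensor_space"
proof -
  obtain n :: nat and a b where t: "t = (\<Sum>i<n. a i \<otimes> b i)"
    using assms(3) by (auto simp: tensor_space_def)
  have "(f \<otimes>\<^sub>m g) (\<Sum>i<k. a i \<otimes> b i) = (\<Sum>i<k. f (a i) \<otimes> g (b i))" for k
  proof (induction k)
    case 0
    show ?case by (auto simp: tmap_def fun_eq_iff)
  next
    case (Suc k)
    show ?case unfolding sum.lessThan_Suc tmap_add Suc tmap_tens[OF assms(1,2)] ..
  qed
  then show ?thesis
    unfolding t tensor_space_def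
    by (intro CollectI exI[of _ n] exI[of _ "\<lambda>i. f (a i)"] exI[of _ "\<lambda>i. g (b i)"])
qed

text \<open>Tensors are total functions extended by 0, so extensionality has a separate case for
  arguments outside \<open>dual\<close>, where no expansion in functionals is available.\<close>

lemma tensor_eqI:
  assumes "\<And>\<phi> \<psi>. \<phi> \<in> dual \<Longrightarrow> \<psi> \<in> dual \<Longrightarrow> s \<phi> \<psi> = t \<phi> \<psi>"
    and "\<And>\<phi> \<psi>. \<not> (\<phi> \<in> dual \<and> \<psi> \<in> dual) \<Longrightarrow> s \<phi> \<psi> = t \<phi> \<psi>"
  shows "s = t"
  using assms by (intro ext) blast

lemma tensor3_eqI:
  assumes "\<And>\<phi> \<psi> \<chi>. \<phi> \<in> dual \<Longrightarrow> \<psi> \<in> dual \<Longrightarrow> \<chi> \<in> dual \<Longrightarrow> S \<phi> \<psi> \<chi> = T \<phi> \<psi> \<chi>"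
    and "\<And>\<phi> \<psi> \<chi>. \<not> (\<phi> \<in> dual \<and> \<psi> \<in> dual \<and> \<chi> \<in> dual) \<Longrightarrow> S \<phi> \<psi> \<chi> = T \<phi> \<psi> \<chi>"
  shows "S = T"
  using assms by (intro ext) blast

end

section \<open>Multiplication operators and normal forms of words in a dialgebra\<close>

context dialgebra
begin

lemma
  linear_lmult_rhd: "Vector_Spaces.linear scale scale (lmult (\<rhd>) x)" and
  linear_rmult_rhd: "Vector_Spaces.linear scale scale (rmult (\<rhd>) x)" and
  linear_lmult_lhd: "Vector_Spaces.linear scale scale (lmult (\<lhd>) x)" and
  linear_rmult_lhd: "Vector_Spaces.linear scale scale (rmult (\<lhd>) x)"
  using linear_rhd linear_lhd by (simp_all add: lmult_def rmult_def)

lemma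
  rhd_add: "x \<rhd> (y + z) = x \<rhd> y + x \<rhd> z" "(x + y) \<rhd> z = x \<rhd> z + y \<rhd> z" and
  lhd_add: "x \<lhd> (y + z) = x \<lhd> y + x \<lhd> z" "(x + y) \<lhd> z = x \<lhd> z + y \<lhd> z" and
  rhd_scale: "x \<rhd> (c *s y) = c *s (x \<rhd> y)" "(c *s x) \<rhd> y = c *s (x \<rhd> y)" and
  lhd_scale: "x \<lhd> (c *s y) = c *s (x \<lhd> y)" "(c *s x) \<lhd> y = c *s (x \<lhd> y)"
  using linear_rhd linear_lhd unfolding linear_scale_iff by blast+

lemma
  rhd_diff: "x \<rhd> (y - z) = x \<rhd> y - x \<rhd> z" "(x - y) \<rhd> z = x \<rhd> z - y \<rhd> z" and
  lhd_diff: "x \<lhd> (y - z) = x \<lhd> y - x \<lhd> z" "(x - y) \<lhd> z = x \<lhd> z - y \<lhd> z"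
  using rhd_add(1)[of x "y - z" z] rhd_add(2)[of "x - y" y z]
    lhd_add(1)[of x "y - z" z] lhd_add(2)[of "x - y" y z] by simp_all

lemma
  linear_lmult_star: "Vector_Spaces.linear scale scale (lmult (\<star>) x)" and
  linear_rmult_star: "Vector_Spaces.linear scale scale (rmult (\<star>) x)"
  by (simp_all add: linear_scale_iff lmult_def rmult_def star_def rhd_add lhd_add rhd_scale lhd_scale
      scale_right_diff_distrib)

lemma lhd_minus: "x \<lhd> (- y) = - (x \<lhd> y)" "(- x) \<lhd> y = - (x \<lhd> y)"
  and rhd_minus: "x \<rhd> (- y) = - (x \<rhd> y)" "(- x) \<rhd> y = - (x \<rhd> y)"
  using lhd_diff(1)[of x 0 y] lhd_diff(2)[of 0 x y] rhd_diff(1)[of x 0 y] rhd_diff(2)[of 0 x y]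
    lhd_diff(1)[of x 0 0] lhd_diff(2)[of 0 0 y] rhd_diff(1)[of x 0 0] rhd_diff(2)[of 0 0 y]
  by simp_all

lemma lhd_rhd: "x \<lhd> (y \<rhd> z) = x \<lhd> (y \<lhd> z)"
  using dialg1 assoc_lhd by simp

text \<open>Oriented towards right-nested words, these rules decide equality of words in a dialgebra.\<close>

lemmas word_simps = assoc_rhd assoc_lhd lhd_rhd dialg2 dialg3

lemmas linear_mult = linear_lmult_rhd linear_rmult_rhd linear_lmult_lhd linear_rmult_lhd
  linear_lmult_star linear_rmult_star

text \<open>Two forms of the same closure property: with \<open>\<circ>\<close>, as produced by
  \<open>tmap\<close>, and with explicit abstractions, as they remain once \<open>lmult\<close> and
  \<open>rmult\<close> are unfolded.\<close>

lemmas dual_comp_mult = linear_mult[THEN dual_comp]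
  linear_mult[unfolded lmult_def rmult_def, THEN dual_linear_comp[rotated]]

end

subsection \<open>The comultiplications of a tensor\<close>

text \<open>Fixing one decomposition of \<open>r\<close> turns every evaluation on functionals into
  a finite sum over the same index range.\<close>

locale dialgebra_tensor = dialgebra +
  fixes n :: nat and a b :: "nat \<Rightarrow> 'b" and r :: "('a, 'b) tensor2"
  assumes r_eq: "r = (\<Sum>i<n. a i \<otimes> b i)"
begin

abbreviation delta_rhd ("\<delta>\<^sub>\<rhd>") where "\<delta>\<^sub>\<rhd> \<equiv> delta_rhd_of r"
abbreviation delta_lhd ("\<delta>\<^sub>\<lhd>") where "\<delta>\<^sub>\<lhd> \<equiv> delta_lhd_of r"

lemma r_apply: "\<phi> \<in> dual \<Longrightarrow> \<psi> \<in> dual \<Longrightarrow> r \<phi> \<psi> = (\<Sum>i<n. \<phi> (a i) * \<psi> (b i))"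
  by (simp add: r_eq sum_apply tens_def)

lemma r_mem: "r \<in> tensor_space"
  unfolding r_eq tensor_space_def by blast

lemma delta_rhd_of_apply:
  assumes "\<phi> \<in> dual" "\<psi> \<in> dual"
  shows "\<delta>\<^sub>\<rhd> x \<phi> \<psi> = (\<Sum>i<n. \<phi> (a i \<star> x) * \<psi> (b i)) + (\<Sum>i<n. \<phi> (a i) * \<psi> (x \<lhd> b i))"
  using assms by (simp add: delta_rhd_of_def tmap_def r_apply dual_comp_mult)
    (simp add: lmult_def rmult_def)

lemma delta_lhd_of_apply:
  assumes "\<phi> \<in> dual" "\<psi> \<in> dual"
  shows "\<delta>\<^sub>\<lhd> x \<phi> \<psi> = (\<Sum>i<n. \<phi> (a i \<rhd> x) * \<psi> (b i)) - (\<Sum>i<n. \<phi> (a i) * \<psi> (x \<star> b i))"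
  using assms by (simp add: delta_lhd_of_def tmap_def r_apply dual_comp_mult)
    (simp add: lmult_def rmult_def)

text \<open>The sign is absorbed into the second operator, so that both comultiplications are sums
  of the same shape.\<close>

lemma delta_lhd_of_apply':
  assumes "\<phi> \<in> dual" "\<psi> \<in> dual"
  shows "\<delta>\<^sub>\<lhd> x \<phi> \<psi> =
    (\<Sum>i<n. \<phi> (a i \<rhd> x) * \<psi> (b i)) + (\<Sum>i<n. \<phi> (a i) * \<psi> (- (x \<star> b i)))"
  using assms by (simp add: delta_lhd_of_apply dual_minus sum_negf)

lemma delta_of_eq_0:
  assumes "\<not> (\<phi> \<in> dual \<and> \<psi> \<in> dual)"
  shows "\<delta>\<^sub>\<rhd> x \<phi> \<psi> = 0" "\<delta>\<^sub>\<lhd> x \<phi> \<psi> = 0"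
  using assms by (auto simp: delta_rhd_of_def delta_lhd_of_def tmap_def)

lemmas multilinear = star_def rhd_diff lhd_diff rhd_add lhd_add rhd_scale lhd_scale word_simps
  dual_diff dual_add dual_scale dual_minus
  left_diff_distrib right_diff_distrib sum.distrib sum_subtractf sum_negf

lemma linear_delta_rhd_of: "Vector_Spaces.linear scale tensor_scale \<delta>\<^sub>\<rhd>"
  unfolding linear_tensor_scale_iff
proof (intro conjI allI; rule tensor_eqI)
qed (auto simp: delta_rhd_of_apply delta_of_eq_0 tensor_scale_def multilinear sum_distrib_left algebra_simps)

lemma linear_delta_lhd_of: "Vector_Spaces.linear scale tensor_scale \<delta>\<^sub>\<lhd>"
  unfolding linear_tensor_scale_iff
proof (intro conjI allI; rule tensor_eqI)
qed (auto simp: delta_lhd_of_apply delta_of_eq_0 tensor_scale_def multilinear sum_distrib_left algebra_simps)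

lemma delta_rhd_of_mem: "\<delta>\<^sub>\<rhd> x \<in> tensor_space"
  unfolding delta_rhd_of_def
  by (intro tensor_space_add tmap_mem_tensor_space r_mem linear_mult linear_id)

lemma delta_lhd_of_mem: "\<delta>\<^sub>\<lhd> x \<in> tensor_space"
proof -
  \<comment> \<open>The minus sign moves into the linear map, so that closure of
    \<open>tensor_space\<close> under addition suffices.\<close>
  have lin: "Vector_Spaces.linear scale scale (\<lambda>y. - lmult (\<star>) x y)"
    using linear_lmult_star[of x] by (simp add: linear_scale_iff)
  have "\<delta>\<^sub>\<lhd> x = (rmult (\<rhd>) x \<otimes>\<^sub>m id) r + (id \<otimes>\<^sub>m (\<lambda>y. - lmult (\<star>) x y)) r"
    by (rule tensor_eqI)
      (auto simp: delta_lhd_of_def tmap_def r_apply dual_comp_mult dual_comp[OF lin] dual_minus sum_negf)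
  then show ?thesis
    by (simp only:) (intro tensor_space_add tmap_mem_tensor_space r_mem linear_mult linear_id lin)
qed

section \<open>Iterated comultiplications as elements of the tensor cube\<close>

abbreviation "r12_r13 m \<equiv> prod12_13 n m a b a b"
abbreviation "r23_r12 m \<equiv> prod23_12 n m a b a b"
abbreviation "r13_r23 m \<equiv> prod13_23 n m a b a b"

text \<open>
  Both comultiplications have the form \<open>x \<mapsto> (\<Sum>i<n. m (a i) x \<otimes> b i + a i \<otimes> k x (b i))\<close>, with
  \<open>(m, k) = (\<star>, \<lhd>)\<close> for \<open>\<delta>\<^sub>\<rhd>\<close> and \<open>(m, k) = (\<rhd>, - \<star>)\<close> for \<open>\<delta>\<^sub>\<lhd>\<close>.
\<close>

lemma id_tens_comult:
  assumes \<delta>: "\<And>x \<phi> \<psi>. \<phi> \<in> dual \<Longrightarrow> \<psi> \<in> dual \<Longrightarrow>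
      \<delta> x \<phi> \<psi> = (\<Sum>i<n. \<phi> (m (a i) x) * \<psi> (b i)) + (\<Sum>i<n. \<phi> (a i) * \<psi> (k x (b i)))"
    and \<delta>': "\<And>x \<phi> \<psi>. \<phi> \<in> dual \<Longrightarrow> \<psi> \<in> dual \<Longrightarrow>
      \<delta>' x \<phi> \<psi> = (\<Sum>i<n. \<phi> (m' (a i) x) * \<psi> (b i)) + (\<Sum>i<n. \<phi> (a i) * \<psi> (k' x (b i)))"
    and lin: "Vector_Spaces.linear scale tensor_scale \<delta>"
    and d: "\<phi> \<in> dual" "\<psi> \<in> dual" "\<chi> \<in> dual"
  shows "id_tens \<delta> (\<delta>' x) \<phi> \<psi> \<chi> =
    r23_r12 m (\<lambda>u. \<phi> (m' u x)) \<psi> \<chi> + r13_r23 k (\<lambda>u. \<phi> (m' u x)) \<psi> \<chi> +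
    r23_r12 (\<lambda>u v. m u (k' x v)) \<phi> \<psi> \<chi> + r13_r23 (\<lambda>u v. k (k' x u) v) \<phi> \<psi> \<chi>"
proof -
  \<comment> \<open>Linearity of \<delta> makes \<open>\<lambda>y. \<delta> y \<psi> \<chi>\<close>
    a functional, so the formula for \<open>\<delta>'\<close> applies to it.\<close>
  have "id_tens \<delta> (\<delta>' x) \<phi> \<psi> \<chi> =
      (\<Sum>i<n. \<phi> (m' (a i) x) * \<delta> (b i) \<psi> \<chi>) + (\<Sum>i<n. \<phi> (a i) * \<delta> (k' x (b i)) \<psi> \<chi>)"
    using d linear_apply_tens[OF lin] by (simp add: id_tens_def \<delta>')
  \<comment> \<open>Swapping the sums in the two \<open>prod23_12\<close> terms puts the index
    coming from \<open>\<delta>'\<close> outside, as in the expansion above.\<close>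
  then show ?thesis
    unfolding prod23_12_def prod13_23_def \<delta>[OF d(2,3)]
    by (subst (1 3) sum.swap)
      (simp add: sum_distrib_left sum.distrib distrib_left mult.assoc)
qed

lemma tens_id_comult:
  assumes \<delta>: "\<And>x \<phi> \<psi>. \<phi> \<in> dual \<Longrightarrow> \<psi> \<in> dual \<Longrightarrow>
      \<delta> x \<phi> \<psi> = (\<Sum>i<n. \<phi> (m (a i) x) * \<psi> (b i)) + (\<Sum>i<n. \<phi> (a i) * \<psi> (k x (b i)))"
    and \<delta>': "\<And>x \<phi> \<psi>. \<phi> \<in> dual \<Longrightarrow> \<psi> \<in> dual \<Longrightarrow>
      \<delta>' x \<phi> \<psi> = (\<Sum>i<n. \<phi> (m' (a i) x) * \<psi> (b i)) + (\<Sum>i<n. \<phi> (a i) * \<psi> (k' x (b i)))"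
    and lin: "Vector_Spaces.linear scale tensor_scale \<delta>"
    and d: "\<phi> \<in> dual" "\<psi> \<in> dual" "\<chi> \<in> dual"
  shows "tens_id \<delta> (\<delta>' x) \<phi> \<psi> \<chi> =
    r12_r13 (\<lambda>u v. m u (m' v x)) \<phi> \<psi> \<chi> + r23_r12 (\<lambda>u v. k (m' u x) v) \<phi> \<psi> \<chi> +
    r12_r13 m \<phi> \<psi> (\<lambda>w. \<chi> (k' x w)) + r23_r12 k \<phi> \<psi> (\<lambda>w. \<chi> (k' x w))"
proof -
  have "tens_id \<delta> (\<delta>' x) \<phi> \<psi> \<chi> =
      (\<Sum>i<n. \<delta> (m' (a i) x) \<phi> \<psi> * \<chi> (b i)) + (\<Sum>i<n. \<delta> (a i) \<phi> \<psi> * \<chi> (k' x (b i)))"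
    using d linear_apply_tens[OF lin] by (simp add: tens_id_def \<delta>')
  \<comment> \<open>Here it is the two \<open>prod12_13\<close> terms whose order of summation
    differs from the expansion.\<close>
  then show ?thesis
    unfolding prod23_12_def prod12_13_def \<delta>[OF d(1,2)]
    by (subst (1 3) sum.swap)
      (simp add: sum_distrib_right sum.distrib distrib_right mult.assoc)
qed

text \<open>In these names the first sign belongs to the comultiplication applied to a tensor
  factor, the second to the one evaluated at \<open>x\<close>.\<close>

lemmas rhd_rhd_comult =
  id_tens_comult[where \<delta> = "\<delta>\<^sub>\<rhd>" and \<delta>' = "\<delta>\<^sub>\<rhd>" and m = "(\<star>)" and k = "(\<lhd>)"
      and m' = "(\<star>)" and k' = "(\<lhd>)", OF delta_rhd_of_apply delta_rhd_of_apply linear_delta_rhd_of]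
  tens_id_comult[where \<delta> = "\<delta>\<^sub>\<rhd>" and \<delta>' = "\<delta>\<^sub>\<rhd>" and m = "(\<star>)" and k = "(\<lhd>)"
      and m' = "(\<star>)" and k' = "(\<lhd>)", OF delta_rhd_of_apply delta_rhd_of_apply linear_delta_rhd_of]
lemmas rhd_lhd_comult =
  id_tens_comult[where \<delta> = "\<delta>\<^sub>\<rhd>" and \<delta>' = "\<delta>\<^sub>\<lhd>" and m = "(\<star>)" and k = "(\<lhd>)"
      and m' = "(\<rhd>)" and k' = "\<lambda>x y. - (x \<star> y)", OF delta_rhd_of_apply delta_lhd_of_apply' linear_delta_rhd_of]
  tens_id_comult[where \<delta> = "\<delta>\<^sub>\<rhd>" and \<delta>' = "\<delta>\<^sub>\<lhd>" and m = "(\<star>)" and k = "(\<lhd>)"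
      and m' = "(\<rhd>)" and k' = "\<lambda>x y. - (x \<star> y)", OF delta_rhd_of_apply delta_lhd_of_apply' linear_delta_rhd_of]
lemmas lhd_rhd_comult =
  id_tens_comult[where \<delta> = "\<delta>\<^sub>\<lhd>" and \<delta>' = "\<delta>\<^sub>\<rhd>" and m = "(\<rhd>)" and k = "\<lambda>x y. - (x \<star> y)"
      and m' = "(\<star>)" and k' = "(\<lhd>)", OF delta_lhd_of_apply' delta_rhd_of_apply linear_delta_lhd_of]
  tens_id_comult[where \<delta> = "\<delta>\<^sub>\<lhd>" and \<delta>' = "\<delta>\<^sub>\<rhd>" and m = "(\<rhd>)" and k = "\<lambda>x y. - (x \<star> y)"
      and m' = "(\<star>)" and k' = "(\<lhd>)", OF delta_lhd_of_apply' delta_rhd_of_apply linear_delta_lhd_of]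
lemmas lhd_lhd_comult =
  id_tens_comult[where \<delta> = "\<delta>\<^sub>\<lhd>" and \<delta>' = "\<delta>\<^sub>\<lhd>" and m = "(\<rhd>)" and k = "\<lambda>x y. - (x \<star> y)"
      and m' = "(\<rhd>)" and k' = "\<lambda>x y. - (x \<star> y)", OF delta_lhd_of_apply' delta_lhd_of_apply' linear_delta_lhd_of]
  tens_id_comult[where \<delta> = "\<delta>\<^sub>\<lhd>" and \<delta>' = "\<delta>\<^sub>\<lhd>" and m = "(\<rhd>)" and k = "\<lambda>x y. - (x \<star> y)"
      and m' = "(\<rhd>)" and k' = "\<lambda>x y. - (x \<star> y)", OF delta_lhd_of_apply' delta_lhd_of_apply' linear_delta_lhd_of]

lemmas comult_comult = rhd_rhd_comult rhd_lhd_comult lhd_rhd_comult lhd_lhd_comult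

end

subsection \<open>Solutions of the DAYBE with invariant skew-symmetric part\<close>

locale invariant_daybe_solution = dialgebra_tensor +
  assumes daybe: "daybe_sum n a b = 0"
    and skew_part_invariant: "invariant (skew_part r)"
begin

abbreviation skew ("\<alpha>") where "\<alpha> \<equiv> skew_part r"

lemma skew_apply:
  "\<phi> \<in> dual \<Longrightarrow> \<psi> \<in> dual \<Longrightarrow> \<alpha> \<phi> \<psi> = (\<Sum>i<n. \<phi> (a i) * \<psi> (b i)) - (\<Sum>i<n. \<phi> (b i) * \<psi> (a i))"
  by (simp add: skew_part_def flip_def r_apply mult.commute)

lemma skew_antisym: "\<alpha> \<psi> \<phi> = - \<alpha> \<phi> \<psi>"
  by (simp add: skew_part_def flip_def)

text \<open>Invariance under \<open>E_map\<close>, evaluated on functionals, is an adjointness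
  relation moving a multiplication from one slot of \<alpha> to the other. By antisymmetry,
  \<open>skew_lhd_star\<close> and \<open>skew_star_rhd\<close> are this relation and
  \<open>skew_F\<close> with the slots exchanged.\<close>

lemma skew_E:
  assumes "\<phi> \<in> dual" "\<psi> \<in> dual"
  shows "\<alpha> (\<lambda>u. \<phi> (u \<star> x)) \<psi> = - \<alpha> \<phi> (\<lambda>v. \<psi> (x \<lhd> v))"
proof -
  have "E_map x \<alpha> \<phi> \<psi> = 0"
    using skew_part_invariant by (simp add: invariant_def)
  then show ?thesis
    using assms by (simp add: E_map_def tmap_def comp_def lmult_def rmult_def eq_neg_iff_add_eq_0)
qed

lemma skew_F:
  assumes "\<phi> \<in> dual" "\<psi> \<in> dual"
  shows "\<alpha> (\<lambda>u. \<phi> (u \<rhd> x)) \<psi> = \<alpha> \<phi> (\<lambda>v. \<psi> (x \<star> v))"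
proof -
  have "F_map x \<alpha> \<phi> \<psi> = 0"
    using skew_part_invariant by (simp add: invariant_def)
  then show ?thesis
    using assms by (simp add: F_map_def tmap_def comp_def lmult_def rmult_def)
qed

lemma skew_lhd_star:
  assumes "\<phi> \<in> dual" "\<psi> \<in> dual"
  shows "\<alpha> (\<lambda>u. \<phi> (x \<lhd> u)) \<psi> = - \<alpha> \<phi> (\<lambda>v. \<psi> (v \<star> x))"
  using skew_E[OF assms(2,1)] skew_antisym by metis

lemma skew_star_rhd:
  assumes "\<phi> \<in> dual" "\<psi> \<in> dual"
  shows "\<alpha> (\<lambda>u. \<phi> (x \<star> u)) \<psi> = \<alpha> \<phi> (\<lambda>v. \<psi> (v \<rhd> x))"
  using skew_F[OF assms(2,1)] skew_antisym by metis

text \<open>Since \<rhd> is the sum of \<star> and \<lhd>, this is the sum of the two preceding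
  relations.\<close>

lemma skew_rhd_lhd:
  assumes "\<phi> \<in> dual" "\<psi> \<in> dual"
  shows "\<alpha> (\<lambda>u. \<phi> (x \<rhd> u)) \<psi> = \<alpha> \<phi> (\<lambda>v. \<psi> (v \<lhd> x))"
proof -
  have "\<alpha> (\<lambda>u. \<phi> (x \<rhd> u)) \<psi> = \<alpha> (\<lambda>u. \<phi> (x \<star> u)) \<psi> + \<alpha> (\<lambda>u. \<phi> (x \<lhd> u)) \<psi>"
    by (simp add: skew_apply dual_comp_mult assms) (simp add: multilinear assms)
  also have "\<dots> = \<alpha> \<phi> (\<lambda>v. \<psi> (v \<rhd> x)) - \<alpha> \<phi> (\<lambda>v. \<psi> (v \<star> x))"
    by (simp add: skew_star_rhd skew_lhd_star assms)
  also have "\<dots> = \<alpha> \<phi> (\<lambda>v. \<psi> (v \<lhd> x))"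
    by (simp add: skew_apply dual_comp_mult assms) (simp add: multilinear assms)
  finally show ?thesis .
qed

section \<open>The DAYBE and its two cyclic forms\<close>

lemma daybe_cyclic1:
  assumes "\<phi> \<in> dual" "\<psi> \<in> dual" "\<chi> \<in> dual"
  shows "r13_r23 (\<rhd>) \<phi> \<psi> \<chi> = r23_r12 (\<lhd>) \<phi> \<psi> \<chi> + r12_r13 (\<star>) \<phi> \<psi> \<chi>"
proof -
  have "daybe_sum n a b \<phi> \<psi> \<chi> = 0"
    by (simp add: daybe)
  then show ?thesis
    using assms
    by (simp add: daybe_sum_def sum_apply tens3_def sum_subtractf prod13_23_def prod23_12_def prod12_13_def diff_eq_eq add.commute)
qed

text \<open>Cyclically permuting the functionals in the DAYBE gives this equation with some factors
  flipped; the flips are undone one tensor position at a time, each by an adjointness relation for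
  \<alpha>.\<close>

lemma daybe_cyclic2:
  assumes d: "\<phi> \<in> dual" "\<psi> \<in> dual" "\<chi> \<in> dual"
  shows "r12_r13 (\<rhd>) \<phi> \<psi> \<chi> = r13_r23 (\<lhd>) \<phi> \<psi> \<chi> + r23_r12 (\<star>) \<phi> \<psi> \<chi>"
proof -
  \<comment> \<open>A pair \<open>b a\<close> in place of \<open>a b\<close> means that this factor
    is \<tau> \<open>r\<close>.\<close>
  have 0: "prod12_13 n (\<rhd>) b a b a \<phi> \<psi> \<chi> =
      prod13_23 n (\<lhd>) b a a b \<phi> \<psi> \<chi> + prod23_12 n (\<star>) a b b a \<phi> \<psi> \<chi>"
    using daybe_cyclic1[OF d(2,3,1)]
    unfolding prod12_13_def prod23_12_def prod13_23_def
    by (subst (3) sum.swap, subst (asm) (2) sum.swap) (simp add: mult_ac)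
  \<comment> \<open>Flipping the factor in positions 1 and 2 changes both products by the same
    amount, so their difference is preserved.\<close>
  have "(\<Sum>j<n. \<alpha> (\<lambda>u. \<phi> (u \<rhd> a j)) \<psi> * \<chi> (b j)) = (\<Sum>j<n. \<alpha> \<phi> (\<lambda>v. \<psi> (a j \<star> v)) * \<chi> (b j))"
    by (simp add: skew_F d)
  then have 1: "r12_r13 (\<rhd>) \<phi> \<psi> \<chi> - r23_r12 (\<star>) \<phi> \<psi> \<chi> =
      prod12_13 n (\<rhd>) b a a b \<phi> \<psi> \<chi> - prod23_12 n (\<star>) a b b a \<phi> \<psi> \<chi>"
    unfolding prod12_13_def prod23_12_def prod13_23_def
    by (subst (1 3) sum.swap, simp add: skew_apply dual_comp_mult d sum_distrib_left
        sum_distrib_right left_diff_distrib right_diff_distrib sum_subtractf)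
      (simp add: algebra_simps)
  \<comment> \<open>The same for the factor in positions 1 and 3, with the other one already
    flipped.\<close>
  have "(\<Sum>j<n. \<alpha> (\<lambda>u. \<phi> (b j \<rhd> u)) \<chi> * \<psi> (a j)) = (\<Sum>j<n. \<alpha> \<phi> (\<lambda>v. \<chi> (v \<lhd> b j)) * \<psi> (a j))"
    by (simp add: skew_rhd_lhd d)
  then have 2: "prod12_13 n (\<rhd>) b a a b \<phi> \<psi> \<chi> - r13_r23 (\<lhd>) \<phi> \<psi> \<chi> =
      prod12_13 n (\<rhd>) b a b a \<phi> \<psi> \<chi> - prod13_23 n (\<lhd>) b a a b \<phi> \<psi> \<chi>"
    unfolding prod12_13_def prod23_12_def prod13_23_def
    by (subst (2 4) sum.swap, simp add: skew_apply dual_comp_mult d sum_distrib_left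
        sum_distrib_right left_diff_distrib right_diff_distrib sum_subtractf mult_ac)
      (simp add: algebra_simps)
  show ?thesis using 0 1 2 by (simp add: algebra_simps)
qed

text \<open>The other cyclic permutation: the factor in positions 2 and 3 is flipped first, then the
  one in positions 1 and 3.\<close>

lemma daybe_cyclic3:
  assumes d: "\<phi> \<in> dual" "\<psi> \<in> dual" "\<chi> \<in> dual"
  shows "r23_r12 (\<rhd>) \<phi> \<psi> \<chi> = r12_r13 (\<lhd>) \<phi> \<psi> \<chi> + r13_r23 (\<star>) \<phi> \<psi> \<chi>"
proof -
  have 0: "prod23_12 n (\<rhd>) b a a b \<phi> \<psi> \<chi> =
      prod12_13 n (\<lhd>) a b b a \<phi> \<psi> \<chi> + prod13_23 n (\<star>) b a b a \<phi> \<psi> \<chi>"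
    using daybe_cyclic1[OF d(3,1,2)]
    unfolding prod12_13_def prod23_12_def prod13_23_def
    by (simp add: mult_ac)
  have "(\<Sum>j<n. \<alpha> (\<lambda>u. \<psi> (u \<rhd> b j)) \<chi> * \<phi> (a j)) = (\<Sum>j<n. \<alpha> \<psi> (\<lambda>v. \<chi> (b j \<star> v)) * \<phi> (a j))"
    by (simp add: skew_F d)
  then have 1: "r23_r12 (\<rhd>) \<phi> \<psi> \<chi> - r13_r23 (\<star>) \<phi> \<psi> \<chi> =
      prod23_12 n (\<rhd>) b a a b \<phi> \<psi> \<chi> - prod13_23 n (\<star>) a b b a \<phi> \<psi> \<chi>"
    unfolding prod12_13_def prod23_12_def prod13_23_def
    by (subst (1 3) sum.swap, simp add: skew_apply dual_comp_mult d sum_distrib_left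
        sum_distrib_right left_diff_distrib right_diff_distrib sum_subtractf mult_ac)
      (simp add: algebra_simps)
  \<comment> \<open>The sign in this relation is opposite, so the sum of the two products is
    preserved instead of the difference.\<close>
  have "(\<Sum>j<n. \<alpha> (\<lambda>u. \<phi> (a j \<lhd> u)) \<chi> * \<psi> (b j)) = - (\<Sum>j<n. \<alpha> \<phi> (\<lambda>v. \<chi> (v \<star> a j)) * \<psi> (b j))"
    by (simp add: skew_lhd_star d sum_negf)
  then have 2: "r12_r13 (\<lhd>) \<phi> \<psi> \<chi> + prod13_23 n (\<star>) a b b a \<phi> \<psi> \<chi> =
      prod12_13 n (\<lhd>) a b b a \<phi> \<psi> \<chi> + prod13_23 n (\<star>) b a b a \<phi> \<psi> \<chi>"
    unfolding prod12_13_def prod23_12_def prod13_23_def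
    by (subst (2 4) sum.swap, simp add: skew_apply dual_comp_mult d sum_distrib_left
        sum_distrib_right left_diff_distrib right_diff_distrib sum_subtractf mult_ac)
      (simp add: algebra_simps)
  show ?thesis using 1 unfolding 0 2[symmetric] by (simp add: algebra_simps)
qed

text \<open>Moving \<open>y\<close> to the first slot produces
  \<open>x \<lhd> (u \<star> y)\<close>, which is 0 because \<rhd> and \<lhd> agree to the right of
  a \<lhd>.\<close>

lemma skew_lhd_lhd:
  assumes "\<phi> \<in> dual" "\<psi> \<in> dual"
  shows "\<alpha> (\<lambda>u. \<phi> (x \<lhd> u)) (\<lambda>v. \<psi> (y \<lhd> v)) = 0"
proof -
  have "\<alpha> (\<lambda>u. \<phi> (x \<lhd> u)) (\<lambda>v. \<psi> (y \<lhd> v)) = - \<alpha> (\<lambda>u. \<phi> (x \<lhd> (u \<star> y))) \<psi>"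
    using skew_E[of "\<lambda>u. \<phi> (x \<lhd> u)" \<psi> y] by (simp add: dual_comp_mult assms)
  moreover have "(\<lambda>u. \<phi> (x \<lhd> (u \<star> y))) = (\<lambda>_. 0)"
    by (simp add: star_def lhd_diff word_simps dual_zero assms)
  ultimately show ?thesis
    using assms by (simp add: skew_apply dual_iff)
qed

text \<open>Mirror image of \<open>skew_lhd_lhd\<close>: \<rhd> and \<lhd> agree to the left of a
  \<rhd>, so \<open>(y \<star> u) \<rhd> x\<close> is 0.\<close>

lemma skew_rhd_rhd:
  assumes "\<phi> \<in> dual" "\<psi> \<in> dual"
  shows "\<alpha> (\<lambda>u. \<phi> (u \<rhd> x)) (\<lambda>v. \<psi> (v \<rhd> y)) = 0"
proof -
  have "\<alpha> (\<lambda>u. \<phi> (u \<rhd> x)) (\<lambda>v. \<psi> (v \<rhd> y)) = \<alpha> (\<lambda>u. \<phi> ((y \<star> u) \<rhd> x)) \<psi>"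
    using skew_star_rhd[of "\<lambda>u. \<phi> (u \<rhd> x)" \<psi> y] by (simp add: dual_comp_mult assms)
  moreover have "(\<lambda>u. \<phi> ((y \<star> u) \<rhd> x)) = (\<lambda>_. 0)"
    by (simp add: star_def rhd_diff word_simps dual_zero assms)
  ultimately show ?thesis
    using assms by (simp add: skew_apply dual_iff)
qed

lemmas normalize = dual_zero multilinear lhd_minus rhd_minus dual_comp_mult
  prod12_13_def prod23_12_def prod13_23_def

subsection \<open>Co-dialgebra axioms\<close>

lemma coassociative_rhd: "id_tens \<delta>\<^sub>\<rhd> (\<delta>\<^sub>\<rhd> x) = tens_id \<delta>\<^sub>\<rhd> (\<delta>\<^sub>\<rhd> x)" (is "?L = ?R")
proof (rule tensor3_eqI)
  fix \<phi> \<psi> \<chi> assume d: "\<phi> \<in> dual" "\<psi> \<in> dual" "\<chi> \<in> dual"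
  let ?\<phi> = "\<lambda>u. \<phi> (u \<star> x)" and ?\<chi> = "\<lambda>u. \<chi> (x \<lhd> u)"
  \<comment> \<open>The terms with \<open>x\<close> in the middle factor cancel by
    \<open>u \<star> (x \<lhd> v) = (u \<star> x) \<lhd> v\<close>. The rest is collected with
    \<open>u \<star> (v \<star> x) = (u \<rhd> v) \<star> x\<close> and
    \<open>(x \<lhd> u) \<lhd> v = x \<lhd> (u \<rhd> v)\<close>.\<close>
  have "?L \<phi> \<psi> \<chi> - ?R \<phi> \<psi> \<chi> =
     (r13_r23 (\<rhd>) \<phi> \<psi> ?\<chi> - (r23_r12 (\<lhd>) \<phi> \<psi> ?\<chi> + r12_r13 (\<star>) \<phi> \<psi> ?\<chi>))
     - (r12_r13 (\<rhd>) ?\<phi> \<psi> \<chi> - (r13_r23 (\<lhd>) ?\<phi> \<psi> \<chi> + r23_r12 (\<star>) ?\<phi> \<psi> \<chi>))"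
    using d by (simp add: comult_comult) (simp add: normalize algebra_simps)
  also have "\<dots> = 0"
    by (simp add: daybe_cyclic1 daybe_cyclic2 d dual_comp_mult)
  finally show "?L \<phi> \<psi> \<chi> = ?R \<phi> \<psi> \<chi>"
    by simp
qed (auto simp: id_tens_def tens_id_def)

lemma coassociative_lhd: "id_tens \<delta>\<^sub>\<lhd> (\<delta>\<^sub>\<lhd> x) = tens_id \<delta>\<^sub>\<lhd> (\<delta>\<^sub>\<lhd> x)" (is "?L = ?R")
proof (rule tensor3_eqI)
  fix \<phi> \<psi> \<chi> assume d: "\<phi> \<in> dual" "\<psi> \<in> dual" "\<chi> \<in> dual"
  let ?\<phi> = "\<lambda>u. \<phi> (u \<rhd> x)" and ?\<chi> = "\<lambda>u. \<chi> (x \<star> u)"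
  \<comment> \<open>The middle terms cancel by
    \<open>u \<rhd> (x \<star> v) = (u \<rhd> x) \<star> v\<close>; the outer ones use
    \<open>(x \<star> u) \<star> v = - (x \<star> (u \<lhd> v))\<close>.\<close>
  have "?L \<phi> \<psi> \<chi> - ?R \<phi> \<psi> \<chi> =
     (r23_r12 (\<rhd>) ?\<phi> \<psi> \<chi> - (r12_r13 (\<lhd>) ?\<phi> \<psi> \<chi> + r13_r23 (\<star>) ?\<phi> \<psi> \<chi>))
     + (r12_r13 (\<rhd>) \<phi> \<psi> ?\<chi> - (r13_r23 (\<lhd>) \<phi> \<psi> ?\<chi> + r23_r12 (\<star>) \<phi> \<psi> ?\<chi>))"
    using d by (simp add: comult_comult) (simp add: normalize algebra_simps)
  also have "\<dots> = 0"
    by (simp add: daybe_cyclic3 daybe_cyclic2 d dual_comp_mult)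
  finally show "?L \<phi> \<psi> \<chi> = ?R \<phi> \<psi> \<chi>"
    by simp
qed (auto simp: id_tens_def tens_id_def)

lemma id_tens_delta_lhd: "id_tens \<delta>\<^sub>\<lhd> (\<delta>\<^sub>\<lhd> x) = id_tens \<delta>\<^sub>\<rhd> (\<delta>\<^sub>\<lhd> x)" (is "?L = ?R")
proof (rule tensor3_eqI)
  fix \<phi> \<psi> \<chi> assume d: "\<phi> \<in> dual" "\<psi> \<in> dual" "\<chi> \<in> dual"
  let ?\<phi> = "\<lambda>u. \<phi> (u \<rhd> x)"
  \<comment> \<open>The last term is 0, since \<open>(u \<star> v) \<rhd> x = 0\<close>; adding it
    completes the DAYBE tensor.\<close>
  have "?R \<phi> \<psi> \<chi> - ?L \<phi> \<psi> \<chi> =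
     r13_r23 (\<rhd>) ?\<phi> \<psi> \<chi> - (r23_r12 (\<lhd>) ?\<phi> \<psi> \<chi> + r12_r13 (\<star>) ?\<phi> \<psi> \<chi>)"
    using d by (simp add: comult_comult) (simp add: normalize algebra_simps)
  also have "\<dots> = 0"
    by (simp add: daybe_cyclic1 d dual_comp_mult)
  finally show "?L \<phi> \<psi> \<chi> = ?R \<phi> \<psi> \<chi>"
    by simp
qed (auto simp: id_tens_def tens_id_def)

lemma tens_id_delta_rhd_lhd: "tens_id \<delta>\<^sub>\<rhd> (\<delta>\<^sub>\<lhd> x) = id_tens \<delta>\<^sub>\<lhd> (\<delta>\<^sub>\<rhd> x)" (is "?L = ?R")
proof (rule tensor3_eqI)
  fix \<phi> \<psi> \<chi> assume d: "\<phi> \<in> dual" "\<psi> \<in> dual" "\<chi> \<in> dual"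
  let ?\<phi> = "\<lambda>u. \<phi> (u \<star> x)" and ?\<chi> = "\<lambda>u. \<chi> (x \<star> u)"
  \<comment> \<open>The middle terms cancel by \<open>dialg2\<close>; the outer ones use
    \<open>u \<star> (v \<rhd> x) = (u \<lhd> v) \<star> x\<close> and
    \<open>(x \<lhd> u) \<star> v = x \<star> (u \<rhd> v)\<close>.\<close>
  have "?L \<phi> \<psi> \<chi> - ?R \<phi> \<psi> \<chi> =
     (r13_r23 (\<rhd>) \<phi> \<psi> ?\<chi> - (r23_r12 (\<lhd>) \<phi> \<psi> ?\<chi> + r12_r13 (\<star>) \<phi> \<psi> ?\<chi>))
     - (r23_r12 (\<rhd>) ?\<phi> \<psi> \<chi> - (r12_r13 (\<lhd>) ?\<phi> \<psi> \<chi> + r13_r23 (\<star>) ?\<phi> \<psi> \<chi>))"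
    using d by (simp add: comult_comult) (simp add: normalize algebra_simps)
  also have "\<dots> = 0"
    by (simp add: daybe_cyclic3 daybe_cyclic1 d dual_comp_mult)
  finally show "?L \<phi> \<psi> \<chi> = ?R \<phi> \<psi> \<chi>"
    by simp
qed (auto simp: id_tens_def tens_id_def)

lemma tens_id_delta_rhd: "tens_id \<delta>\<^sub>\<lhd> (\<delta>\<^sub>\<rhd> x) = tens_id \<delta>\<^sub>\<rhd> (\<delta>\<^sub>\<rhd> x)" (is "?L = ?R")
proof (rule tensor3_eqI)
  fix \<phi> \<psi> \<chi> assume d: "\<phi> \<in> dual" "\<psi> \<in> dual" "\<chi> \<in> dual"
  let ?\<chi> = "\<lambda>u. \<chi> (x \<lhd> u)"
  \<comment> \<open>Again the last term is 0, now by \<open>x \<lhd> (u \<star> v) = 0\<close>, and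
    completes the third cyclic form.\<close>
  have "?R \<phi> \<psi> \<chi> - ?L \<phi> \<psi> \<chi> =
     r23_r12 (\<rhd>) \<phi> \<psi> ?\<chi> - (r12_r13 (\<lhd>) \<phi> \<psi> ?\<chi> + r13_r23 (\<star>) \<phi> \<psi> ?\<chi>)"
    using d by (simp add: comult_comult) (simp add: normalize algebra_simps)
  also have "\<dots> = 0"
    by (simp add: daybe_cyclic3 d dual_comp_mult)
  finally show "?L \<phi> \<psi> \<chi> = ?R \<phi> \<psi> \<chi>"
    by simp
qed (auto simp: id_tens_def tens_id_def)

lemma co_dialgebra: "co_dialgebra scale Basis \<delta>\<^sub>\<rhd> \<delta>\<^sub>\<lhd>"
  by (intro co_dialgebra.intro co_dialgebra_axioms.intro fd_space_axioms)
    (fact linear_delta_rhd_of linear_delta_lhd_of delta_rhd_of_mem delta_lhd_of_mem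
      coassociative_rhd coassociative_lhd id_tens_delta_lhd tens_id_delta_rhd_lhd tens_id_delta_rhd)+

subsection \<open>Compatibility conditions\<close>

lemma id_tens_lhd_delta_lhd:
  "(id \<otimes>\<^sub>m lmult (\<lhd>) x) (\<delta>\<^sub>\<lhd> y) =
    (rmult (\<rhd>) y \<otimes>\<^sub>m id) (\<delta>\<^sub>\<rhd> x)" (is "?L = ?R")
proof (rule tensor_eqI)
  fix \<phi> \<psi> assume d: "\<phi> \<in> dual" "\<psi> \<in> dual"
  with d show "?L \<phi> \<psi> = ?R \<phi> \<psi>"
    by (simp add: tmap_def flip_def delta_rhd_of_apply delta_lhd_of_apply skew_apply
        dual_comp_mult)
      (simp add: lmult_def rmult_def normalize algebra_simps)
qed (auto simp: tmap_def flip_def delta_of_eq_0)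

lemma lhd_tens_id_delta_rhd:
  "(lmult (\<lhd>) x \<otimes>\<^sub>m id) (\<delta>\<^sub>\<rhd> y) =
    (id \<otimes>\<^sub>m lmult (\<lhd>) y) (\<tau> (\<delta>\<^sub>\<rhd> x))" (is "?L = ?R")
proof (rule tensor_eqI)
  fix \<phi> \<psi> assume d: "\<phi> \<in> dual" "\<psi> \<in> dual"
  \<comment> \<open>The \<star> summands of both comultiplications are annihilated by the outer
    \<lhd>; the rest differs only in \<open>r\<close> versus \<tau> \<open>r\<close>.\<close>
  have "?L \<phi> \<psi> - ?R \<phi> \<psi> =
      \<alpha> (\<lambda>u. \<phi> (x \<lhd> u)) (\<lambda>v. \<psi> (y \<lhd> v))"
    using d by (simp add: tmap_def flip_def delta_rhd_of_apply delta_lhd_of_apply skew_apply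
        dual_comp_mult)
      (simp add: lmult_def rmult_def normalize algebra_simps)
  also have "\<dots> = 0"
    by (simp add: skew_lhd_lhd d)
  finally show "?L \<phi> \<psi> = ?R \<phi> \<psi>"
    by simp
qed (auto simp: tmap_def flip_def delta_of_eq_0)

lemma rhd_tens_id_flip_delta_lhd:
  "(rmult (\<rhd>) x \<otimes>\<^sub>m id) (\<tau> (\<delta>\<^sub>\<lhd> y)) =
    (id \<otimes>\<^sub>m rmult (\<rhd>) y) (\<delta>\<^sub>\<lhd> x)" (is "?L = ?R")
proof (rule tensor_eqI)
  fix \<phi> \<psi> assume d: "\<phi> \<in> dual" "\<psi> \<in> dual"
  \<comment> \<open>Here the outer \<rhd> annihilates the \<star> summands.\<close>
  have "?L \<phi> \<psi> - ?R \<phi> \<psi> =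
      - \<alpha> (\<lambda>u. \<phi> (u \<rhd> x)) (\<lambda>v. \<psi> (v \<rhd> y))"
    using d by (simp add: tmap_def flip_def delta_rhd_of_apply delta_lhd_of_apply skew_apply
        dual_comp_mult)
      (simp add: lmult_def rmult_def normalize algebra_simps)
  also have "\<dots> = 0"
    by (simp add: skew_rhd_rhd d)
  finally show "?L \<phi> \<psi> = ?R \<phi> \<psi>"
    by simp
qed (auto simp: tmap_def flip_def delta_of_eq_0)

lemma delta_rhd_of_rhd:
  "\<delta>\<^sub>\<rhd> (x \<rhd> y) =
    (id \<otimes>\<^sub>m lmult (\<rhd>) x) (\<delta>\<^sub>\<rhd> y) - (rmult (\<star>) y \<otimes>\<^sub>m id) (\<delta>\<^sub>\<rhd> x - \<delta>\<^sub>\<lhd> x)" (is "?L = ?R")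
proof (rule tensor_eqI)
  fix \<phi> \<psi> assume d: "\<phi> \<in> dual" "\<psi> \<in> dual"
  with d show "?L \<phi> \<psi> = ?R \<phi> \<psi>"
    by (simp add: tmap_def flip_def delta_rhd_of_apply delta_lhd_of_apply skew_apply
        dual_comp_mult)
      (simp add: lmult_def rmult_def normalize algebra_simps)
qed (auto simp: tmap_def flip_def delta_of_eq_0)

lemma delta_rhd_of_lhd:
  "\<delta>\<^sub>\<rhd> (x \<lhd> y) =
    (id \<otimes>\<^sub>m lmult (\<lhd>) x) (\<delta>\<^sub>\<rhd> y - \<delta>\<^sub>\<lhd> y) + (rmult (\<lhd>) y \<otimes>\<^sub>m id) (\<delta>\<^sub>\<rhd> x)" (is "?L = ?R")
proof (rule tensor_eqI)
  fix \<phi> \<psi> assume d: "\<phi> \<in> dual" "\<psi> \<in> dual"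
  with d show "?L \<phi> \<psi> = ?R \<phi> \<psi>"
    by (simp add: tmap_def flip_def delta_rhd_of_apply delta_lhd_of_apply skew_apply
        dual_comp_mult)
      (simp add: lmult_def rmult_def normalize algebra_simps)
qed (auto simp: tmap_def flip_def delta_of_eq_0)

lemma delta_lhd_of_rhd:
  "\<delta>\<^sub>\<lhd> (x \<rhd> y) =
    (id \<otimes>\<^sub>m lmult (\<star>) x) (\<delta>\<^sub>\<lhd> y) + (rmult (\<rhd>) y \<otimes>\<^sub>m id) (\<delta>\<^sub>\<lhd> x)" (is "?L = ?R")
proof (rule tensor_eqI)
  fix \<phi> \<psi> assume d: "\<phi> \<in> dual" "\<psi> \<in> dual"
  with d show "?L \<phi> \<psi> = ?R \<phi> \<psi>"
    by (simp add: tmap_def flip_def delta_rhd_of_apply delta_lhd_of_apply skew_apply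
        dual_comp_mult)
      (simp add: lmult_def rmult_def normalize algebra_simps)
qed (auto simp: tmap_def flip_def delta_of_eq_0)

lemma delta_lhd_of_lhd:
  "\<delta>\<^sub>\<lhd> (x \<lhd> y) =
    (rmult (\<lhd>) y \<otimes>\<^sub>m id) (\<delta>\<^sub>\<lhd> x) - (id \<otimes>\<^sub>m lmult (\<star>) x) (\<delta>\<^sub>\<rhd> y - \<delta>\<^sub>\<lhd> y)" (is "?L = ?R")
proof (rule tensor_eqI)
  fix \<phi> \<psi> assume d: "\<phi> \<in> dual" "\<psi> \<in> dual"
  with d show "?L \<phi> \<psi> = ?R \<phi> \<psi>"
    by (simp add: tmap_def flip_def delta_rhd_of_apply delta_lhd_of_apply skew_apply
        dual_comp_mult)
      (simp add: lmult_def rmult_def normalize algebra_simps)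
qed (auto simp: tmap_def flip_def delta_of_eq_0)

lemma star_tens_id_delta_rhd:
  "(lmult (\<star>) x \<otimes>\<^sub>m id) (\<delta>\<^sub>\<rhd> y) + (id \<otimes>\<^sub>m lmult (\<lhd>) y) (\<tau> (\<delta>\<^sub>\<lhd> x)) =
    (rmult (\<star>) y \<otimes>\<^sub>m id) (\<tau> (\<delta>\<^sub>\<rhd> x - \<delta>\<^sub>\<lhd> x)) + (id \<otimes>\<^sub>m rmult (\<lhd>) x) (\<delta>\<^sub>\<rhd> y)" (is "?L = ?R")
proof (rule tensor_eqI)
  fix \<phi> \<psi> assume d: "\<phi> \<in> dual" "\<psi> \<in> dual"
  have [simp]: "(\<lambda>u. \<phi> (x \<rhd> (u \<star> y))) \<in> dual" "(\<lambda>v. \<psi> ((y \<lhd> v) \<lhd> x)) \<in> dual"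
    using dual_linear_comp[OF dual_linear_comp[OF d(1) linear_lmult_rhd] linear_rmult_star]
      dual_linear_comp[OF dual_linear_comp[OF d(2) linear_rmult_lhd] linear_lmult_lhd]
    by (simp_all add: lmult_def rmult_def)
  \<comment> \<open>The two brackets are values of \<open>E_map y \<alpha>\<close>, with
    \<open>x\<close> absorbed into \<phi> and \<psi> respectively; the remaining term is of the kind
    treated in \<open>skew_lhd_lhd\<close>.\<close>
  have "?L \<phi> \<psi> - ?R \<phi> \<psi> =
      (\<alpha> (\<lambda>u. \<phi> (x \<rhd> (u \<star> y))) \<psi> + \<alpha> (\<lambda>u. \<phi> (x \<rhd> u)) (\<lambda>v. \<psi> (y \<lhd> v)))
      - \<alpha> (\<lambda>u. \<phi> (x \<lhd> u)) (\<lambda>v. \<psi> (y \<lhd> v))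
      - (\<alpha> (\<lambda>u. \<phi> (u \<star> y)) (\<lambda>v. \<psi> (v \<lhd> x)) + \<alpha> \<phi> (\<lambda>v. \<psi> ((y \<lhd> v) \<lhd> x)))"
    using d by (simp add: tmap_def flip_def delta_rhd_of_apply delta_lhd_of_apply skew_apply
        dual_comp_mult)
      (simp add: lmult_def rmult_def normalize algebra_simps)
  also have "\<dots> = 0"
    by (simp add: skew_lhd_lhd skew_E[of "\<lambda>u. \<phi> (x \<rhd> u)" \<psi>] skew_E[of \<phi> "\<lambda>v. \<psi> (v \<lhd> x)"] dual_comp_mult d)
  finally show "?L \<phi> \<psi> = ?R \<phi> \<psi>"
    by simp
qed (auto simp: tmap_def flip_def delta_of_eq_0)

lemma lhd_tens_id_flip_delta_lhd:
  "(rmult (\<lhd>) x \<otimes>\<^sub>m id) (\<tau> (\<delta>\<^sub>\<lhd> y)) + (id \<otimes>\<^sub>m rmult (\<rhd>) y) (\<delta>\<^sub>\<rhd> x - \<delta>\<^sub>\<lhd> x) =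
    (lmult (\<star>) y \<otimes>\<^sub>m id) (\<delta>\<^sub>\<rhd> x - \<delta>\<^sub>\<lhd> x) + (id \<otimes>\<^sub>m lmult (\<rhd>) x) (\<tau> (\<delta>\<^sub>\<lhd> y))" (is "?L = ?R")
proof (rule tensor_eqI)
  fix \<phi> \<psi> assume d: "\<phi> \<in> dual" "\<psi> \<in> dual"
  have [simp]: "(\<lambda>u. \<phi> ((y \<star> u) \<lhd> x)) \<in> dual" "(\<lambda>v. \<psi> (x \<rhd> (v \<rhd> y))) \<in> dual"
    using dual_linear_comp[OF dual_linear_comp[OF d(1) linear_rmult_lhd] linear_lmult_star]
      dual_linear_comp[OF dual_linear_comp[OF d(2) linear_lmult_rhd] linear_rmult_rhd]
    by (simp_all add: lmult_def rmult_def)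
  \<comment> \<open>Both brackets are instances of \<open>skew_star_rhd\<close> for
    \<open>y\<close>, with \<open>x\<close> absorbed into one of the functionals.\<close>
  have "?L \<phi> \<psi> - ?R \<phi> \<psi> =
      (\<alpha> (\<lambda>u. \<phi> ((y \<star> u) \<lhd> x)) \<psi> - \<alpha> (\<lambda>u. \<phi> (u \<lhd> x)) (\<lambda>v. \<psi> (v \<rhd> y)))
      - (\<alpha> (\<lambda>u. \<phi> (y \<star> u)) (\<lambda>v. \<psi> (x \<rhd> v)) - \<alpha> \<phi> (\<lambda>v. \<psi> (x \<rhd> (v \<rhd> y))))"
    using d by (simp add: tmap_def flip_def delta_rhd_of_apply delta_lhd_of_apply skew_apply
        dual_comp_mult)
      (simp add: lmult_def rmult_def normalize algebra_simps)
  also have "\<dots> = 0"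
    by (simp add: skew_star_rhd[of "\<lambda>u. \<phi> (u \<lhd> x)" \<psi>] skew_star_rhd[of \<phi> "\<lambda>v. \<psi> (x \<rhd> v)"] dual_comp_mult d)
  finally show "?L \<phi> \<psi> = ?R \<phi> \<psi>"
    by simp
qed (auto simp: tmap_def flip_def delta_of_eq_0)

lemma bi_dialgebra: "bi_dialgebra scale Basis (\<rhd>) (\<lhd>) \<delta>\<^sub>\<rhd> \<delta>\<^sub>\<lhd>"
\<comment> \<open>\<open>delta_star\<close> belongs to the co-dialgebra structure, so the
  compatibility lemmas are stated with the difference it abbreviates.\<close>
proof (rule bi_dialgebra.intro[OF dialgebra_axioms co_dialgebra], rule bi_dialgebra_axioms.intro,
    unfold co_dialgebra.delta_star_def[OF co_dialgebra])
qed (rule id_tens_lhd_delta_lhd lhd_tens_id_delta_rhd rhd_tens_id_flip_delta_lhd delta_rhd_of_rhd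
    delta_rhd_of_lhd delta_lhd_of_rhd delta_lhd_of_lhd star_tens_id_delta_rhd
    lhd_tens_id_flip_delta_lhd)+

end

section \<open>The theorem for a tensor without a fixed decomposition, and the symmetric
  case\<close>

lemma (in dialgebra) bi_dialgebra_of_daybe_solution:
  assumes "daybe_solution r" "invariant (skew_part r)"
  shows "bi_dialgebra scale Basis (\<rhd>) (\<lhd>) (delta_rhd_of r) (delta_lhd_of r)"
proof -
  obtain n a b where "r = (\<Sum>i<n. a i \<otimes> b i)" "daybe_sum n a b = 0"
    using assms(1) by (auto simp: daybe_solution_def)
  then interpret invariant_daybe_solution scale Basis rhd lhd n a b r
    using assms(2) by (intro invariant_daybe_solution.intro dialgebra_tensor.intro dialgebra_axioms
        dialgebra_tensor_axioms.intro invariant_daybe_solution_axioms.intro)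
  show ?thesis by (fact bi_dialgebra)
qed

text \<open>The skew-symmetric part is 0, and the operators \<open>E_map x\<close> and
  \<open>F_map x\<close> send 0 to 0.\<close>

lemma (in dialgebra) symmetric_imp_invariant:
  assumes "symmetric r"
  shows "invariant (skew_part r)"
proof -
  have "skew_part r = 0"
    using assms by (simp add: symmetric_def skew_part_def)
  moreover have "(f \<otimes>\<^sub>m g) 0 = 0" for f g
    by (simp add: tmap_def fun_eq_iff)
  ultimately show ?thesis
    by (simp only: invariant_def E_map_def F_map_def) simp
qed

theorem theorem3p18:
  fixes scale :: "'f::field_char_0 \<Rightarrow> 'v::ab_group_add \<Rightarrow> 'v"
    and Basis :: "'v set"
    and rhd lhd :: "'v \<Rightarrow> 'v \<Rightarrow> 'v"
    and r :: "('f, 'v) tensor2"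
  assumes "dialgebra scale Basis rhd lhd"
    and "r \<in> fd_space.tensor_space scale"
  shows "(dialgebra.daybe_solution scale rhd lhd r
            \<and> dialgebra.invariant scale rhd lhd (dialgebra.skew_part r)
          \<longrightarrow> bi_dialgebra scale Basis rhd lhd
                (dialgebra.delta_rhd_of scale rhd lhd r) (dialgebra.delta_lhd_of scale rhd lhd r))
       \<and> (dialgebra.daybe_solution scale rhd lhd r \<and> dialgebra.symmetric r
          \<longrightarrow> bi_dialgebra scale Basis rhd lhd
                (dialgebra.delta_rhd_of scale rhd lhd r) (dialgebra.delta_lhd_of scale rhd lhd r))"
proof -
  interpret dialgebra scale Basis rhd lhd by fact
  show ?thesis
    by (intro conjI impI; elim conjE)
      (fact bi_dialgebra_of_daybe_solution,
        rule bi_dialgebra_of_daybe_solution, assumption, rule symmetric_imp_invariant)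
qed

end
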